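(* Let $\alpha,\beta,\lambda,\rho>0$, let $\mathcal{A}:\mathbb{R}^{n_1\times n_2}\to\mathbb{R}^{n_3}$ be linear, let $b\in\mathbb{R}^{n_3}$, and let $$\varepsilon(X,W)=\tfrac12\|\mathcal{A}X-b\|_2^2+\lambda(1+\alpha\beta)\|W\|_*+\lambda\beta\hat\Psi(X)+\tfrac{\rho}{2}\|X-W\|_F^2,\qquad X,W\in\mathbb{R}^{n_1\times n_2}.$$ Let $\{(W^{(s)},X^{(s)})\}_{s\ge1}$ be the sequence generated from an initial matrix $X^{(0)}\in\mathbb{R}^{n_1\times n_2}$ by $$W^{(s)}=\mathcal{D}_\tau(X^{(s-1)}),\quad \tau=\frac{\lambda(1+\alpha\beta)}{\rho},\qquad X^{(s)}=X^{(s-1)}+\Delta X,$$ where $\Delta X$ solves the linear system $$(\mathcal{A}^*\mathcal{A}+\rho\mathcal{I})\Delta X=\mathcal{A}^*(b-\mathcal{A}X^{(s-1)})-\lambda\beta D_X\hat\Psi(X^{(s-1)})+\rho(W^{(s)}-X^{(s-1)}).$$ Then there exists a subsequence of $\{(W^{(s)},X^{(s)})\}$ that converges to a critical point of $\varepsilon$.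
   Context: Let $m=\min\{n_1,n_2\}$ and let $\sigma_1(X)\ge\dots\ge\sigma_m(X)\ge0$ be the singular values of $X\in\mathbb{R}^{n_1\times n_2}$; $\|X\|_*=\sum_{i=1}^m\sigma_i(X)$ is the nuclear norm and $\|\cdot\|_F$ the Frobenius norm. Put $\varphi(t)=\frac{\alpha|t|}{1+\alpha|t|}$, $\hat\Phi(X)=\sum_{i=1}^m\varphi(\sigma_i(X))$ and $\hat\Psi(X)=\hat\Phi(X)-\alpha\|X\|_*$. The function $\hat\Psi$ is Gateaux differentiable, and $D_X\hat\Psi(X)$ denotes its Gateaux derivative at $X$, identified with a matrix (the gradient) via the Frobenius inner product. $\mathcal{A}^*$ is the adjoint of $\mathcal{A}$ and $\mathcal{I}$ the identity operator. The singular value soft-thresholding operator is $\mathcal{D}_\tau(X)=U\,\mathrm{diag}(\max\{\sigma_i(X)-\tau,0\})\,V^*$, where $X=U\Sigma V^*$ is a singular value decomposition. A critical point of $\varepsilon$ is a pair $(W^*,X^* )$ such that $0\in\partial_W\varepsilon(X^*,W^* )$ (convex subdifferential in $W$) and $D_X\varepsilon(X^*,W^* )=0$. *)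

theory Defs
  imports "HOL-Analysis.Analysis" "HOL-Computational_Algebra.Computational_Algebra"
begin

text \<open>
  An \<open>n1 \<times> n2\<close> real matrix has type \<^typ>\<open>real^'n2^'n1\<close>, where \<open>n1\<close> and \<open>n2\<close> are the
  cardinalities of the index types. The library's inner product and norm on this type are the
  Frobenius inner product and the Frobenius norm.
\<close>

definition charpoly :: "real^'n^'n \<Rightarrow> real poly" where
  "charpoly A = det (mat [:0, 1:] - map_matrix (\<lambda>a. [:a:]) A)"

text \<open>
  Singular values are the square roots of the eigenvalues of \<open>X\<^sup>T X\<close>, listed with multiplicity in
  decreasing order. They are indexed from 0, so \<open>sing_val X i\<close> is the usual \<open>\<sigma>\<close> with index
  \<open>i + 1\<close>, and it is meaningful for \<open>i < rank_bound X\<close>, where \<open>rank_bound X = min n1 n2\<close>. When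
  \<open>n2 > n1\<close>, the list of eigenvalues has \<open>n2 - n1\<close> further entries at its end, all zero,
  which are not singular values.
\<close>

definition rank_bound :: "real^'n2^'n1 \<Rightarrow> nat" where
  "rank_bound X = min CARD('n1) CARD('n2)"

definition sing_val :: "real^'n2^'n1 \<Rightarrow> nat \<Rightarrow> real" where
  "sing_val X i =
     sqrt (rev (sorted_list_of_multiset (proots (charpoly (transpose X ** X)))) ! i)"

definition nuclear_norm :: "real^'n2^'n1 \<Rightarrow> real" where
  "nuclear_norm X = (\<Sum>i<rank_bound X. sing_val X i)"

definition phi :: "real \<Rightarrow> real \<Rightarrow> real" where
  "phi \<alpha> t = \<alpha> * \<bar>t\<bar> / (1 + \<alpha> * \<bar>t\<bar>)"

definition Phi_hat :: "real \<Rightarrow> real^'n2^'n1 \<Rightarrow> real" where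
  "Phi_hat \<alpha> X = (\<Sum>i<rank_bound X. phi \<alpha> (sing_val X i))"

definition Psi_hat :: "real \<Rightarrow> real^'n2^'n1 \<Rightarrow> real" where
  "Psi_hat \<alpha> X = Phi_hat \<alpha> X - \<alpha> * nuclear_norm X"

text \<open>
  Row and column indices have different types, so the main diagonal of a rectangular matrix is
  located by numbering each index type as \<open>0, 1, \<dots>\<close> with \<^const>\<open>to_nat_on\<close>
  (see \<open>to_nat_on_finite\<close>).
\<close>

definition rect_diag :: "(nat \<Rightarrow> real) \<Rightarrow> real^'n2^'n1" where
  "rect_diag d = (\<chi> i j. if to_nat_on UNIV i = to_nat_on UNIV j
                           then d (to_nat_on UNIV i) else 0)"

definition is_svd :: "real^'n2^'n1 \<Rightarrow> real^'n1^'n1 \<Rightarrow> real^'n2^'n2 \<Rightarrow> bool" where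
  "is_svd X U V \<longleftrightarrow> orthogonal_matrix U \<and> orthogonal_matrix V \<and>
     X = U ** rect_diag (sing_val X) ** transpose V"

text \<open>The value below does not depend on which singular value decomposition is chosen.\<close>

definition soft_threshold :: "real \<Rightarrow> real^'n2^'n1 \<Rightarrow> real^'n2^'n1" where
  "soft_threshold \<tau> X = (SOME Y. \<exists>U V. is_svd X U V \<and>
     Y = U ** rect_diag (\<lambda>i. max (sing_val X i - \<tau>) 0) ** transpose V)"

definition has_gateaux_gradient ::
    "('a::real_inner \<Rightarrow> real) \<Rightarrow> 'a \<Rightarrow> 'a \<Rightarrow> bool" where
  "has_gateaux_gradient f G x \<longleftrightarrow>
     (\<forall>h. ((\<lambda>t. f (x + t *\<^sub>R h)) has_real_derivative (G \<bullet> h)) (at 0))"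

definition gateaux_gradient :: "('a::real_inner \<Rightarrow> real) \<Rightarrow> 'a \<Rightarrow> 'a" where
  "gateaux_gradient f x = (THE G. has_gateaux_gradient f G x)"

definition subdifferential :: "('a::real_inner \<Rightarrow> real) \<Rightarrow> 'a \<Rightarrow> 'a set" where
  "subdifferential f x = {G. \<forall>y. f y \<ge> f x + G \<bullet> (y - x)}"

definition objective ::
    "real \<Rightarrow> real \<Rightarrow> real \<Rightarrow> real \<Rightarrow> (real^'n2^'n1 \<Rightarrow> real^'n3) \<Rightarrow> real^'n3
      \<Rightarrow> real^'n2^'n1 \<Rightarrow> real^'n2^'n1 \<Rightarrow> real" where
  "objective \<alpha> \<beta> lam \<rho> A b X W =
     1/2 * (norm (A X - b))\<^sup>2 + lam * (1 + \<alpha> * \<beta>) * nuclear_norm W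
     + lam * \<beta> * Psi_hat \<alpha> X + \<rho>/2 * (norm (X - W))\<^sup>2"

text \<open>
  The functional takes its arguments in the order \<open>X, W\<close>, whereas critical points are pairs
  \<open>(W, X)\<close>.
\<close>

definition is_critical_point ::
    "('a::real_inner \<Rightarrow> 'a \<Rightarrow> real) \<Rightarrow> 'a \<times> 'a \<Rightarrow> bool" where
  "is_critical_point E = (\<lambda>(W, X).
     0 \<in> subdifferential (\<lambda>W'. E X W') W \<and>
     has_gateaux_gradient (\<lambda>X'. E X' W) 0 X)"

end

theory Submission
  imports Defs
begin

text \<open>
  The soft-thresholding step minimises the objective in \<open>W\<close>, because \<open>X - soft_threshold \<tau> X\<close> is a
  subgradient of \<open>\<tau>\<close> times the nuclear norm. The function \<open>Psi_hat \<alpha>\<close> is concave, so linearising it in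
  the \<open>X\<close> step majorises the objective and each step decreases it by at least
  \<open>\<rho>/2 * (norm \<Delta>X)\<^sup>2\<close>. Since \<open>Psi_hat \<alpha> \<ge> - \<alpha> * nuclear_norm\<close> and the nuclear norm is Lipschitz,
  the objective is coercive; hence the iterates are bounded and \<open>\<Delta>X\<close> tends to \<open>0\<close>. Besides being
  concave, \<open>Psi_hat \<alpha>\<close> plus \<open>\<alpha>\<^sup>2\<close> times the squared Frobenius norm is convex. This gives a two-sided
  quadratic estimate around every point, which yields the Gateaux derivative and is closed under limits,
  so both optimality conditions pass to the limit of a convergent subsequence.
\<close>

section \<open>Orthonormal families\<close>

definition orthonormal_on :: "'i set \<Rightarrow> ('i \<Rightarrow> 'a::real_inner) \<Rightarrow> bool" where
  "orthonormal_on I u \<longleftrightarrow> (\<forall>i\<in>I. \<forall>j\<in>I. u i \<bullet> u j = (if i = j then 1 else 0))"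

lemma orthonormal_onD: "orthonormal_on I u \<Longrightarrow> i \<in> I \<Longrightarrow> j \<in> I \<Longrightarrow> u i \<bullet> u j = (if i = j then 1 else 0)"
  by (simp add: orthonormal_on_def)

lemma orthonormal_on_subset: "orthonormal_on I u \<Longrightarrow> J \<subseteq> I \<Longrightarrow> orthonormal_on J u"
  unfolding orthonormal_on_def by blast

lemma orthonormal_on_reindex:
  "orthonormal_on I u \<Longrightarrow> inj_on f J \<Longrightarrow> f ` J \<subseteq> I \<Longrightarrow> orthonormal_on J (\<lambda>j. u (f j))"
  by (auto simp: orthonormal_on_def inj_on_def image_subset_iff)

lemma orthonormal_on_inj: "orthonormal_on I u \<Longrightarrow> inj_on u I"
  unfolding orthonormal_on_def inj_on_def by (metis zero_neq_one)

lemma orthonormal_on_independent: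
  fixes u :: "'i \<Rightarrow> 'a::euclidean_space"
  assumes "orthonormal_on I u"
  shows "independent (u ` I)"
proof (rule pairwise_orthogonal_independent)
  show "pairwise orthogonal (u ` I)"
    using assms by (auto simp: pairwise_def orthogonal_def orthonormal_on_def)
  show "0 \<notin> u ` I"
    using assms unfolding orthonormal_on_def by (metis imageE inner_zero_left zero_neq_one)
qed

lemma orthonormal_on_card_le:
  fixes u :: "'i \<Rightarrow> 'a::euclidean_space"
  assumes "orthonormal_on I u"
  shows "card I \<le> DIM('a)"
  by (metis assms card_image independent_card_le orthonormal_on_independent orthonormal_on_inj)

lemma sum_orthonormal_inner:
  assumes "orthonormal_on I u" "finite I" "i \<in> I"
  shows "(\<Sum>j\<in>I. c j *\<^sub>R u j) \<bullet> u i = c i"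
proof -
  have "(\<Sum>j\<in>I. c j *\<^sub>R u j) \<bullet> u i = (\<Sum>j\<in>I. if j = i then c j else 0)"
    unfolding inner_sum_left using assms(1,3) by (intro sum.cong) (auto simp: orthonormal_on_def)
  then show ?thesis using assms by simp
qed

text \<open>With \<open>p\<close> the orthogonal projection of \<open>x\<close> onto the span of the
  family, both \<open>p \<bullet> p\<close> and \<open>p \<bullet> x\<close> equal the sum of
  squares, so expanding the square of \<open>x - p\<close> gives the bound.\<close>

lemma bessel_inequality:
  assumes "orthonormal_on I u" "finite I"
  shows "(\<Sum>i\<in>I. (u i \<bullet> x)\<^sup>2) \<le> (norm x)\<^sup>2"
proof -
  define p where "p = (\<Sum>i\<in>I. (u i \<bullet> x) *\<^sub>R u i)"
  have px: "p \<bullet> x = (\<Sum>i\<in>I. (u i \<bullet> x)\<^sup>2)"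
    by (simp add: p_def inner_sum_left power2_eq_square)
  have "p \<bullet> p = (\<Sum>i\<in>I. (u i \<bullet> x) * (p \<bullet> u i))"
    by (subst (2) p_def) (simp add: inner_sum_right)
  also have "\<dots> = (\<Sum>i\<in>I. (u i \<bullet> x)\<^sup>2)"
    by (intro sum.cong) (auto simp: p_def sum_orthonormal_inner[OF assms] power2_eq_square)
  finally have "p \<bullet> p = p \<bullet> x" using px by simp
  moreover have "0 \<le> (x - p) \<bullet> (x - p)" by simp
  ultimately show ?thesis
    using px by (simp add: inner_diff_left inner_diff_right inner_commute power2_norm_eq_inner)
qed

section \<open>The spectral theorem\<close>

text \<open>Rayleigh quotient argument: \<open>x\<close> maximises \<open>f y \<bullet> y\<close> on
  the unit sphere of \<open>S\<close>, and \<open>c\<close> is the maximum. The form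
  \<open>q\<close> is then nonnegative on \<open>S\<close> and vanishes at \<open>x\<close>; a
  nonzero residual \<open>c *\<^sub>R x - f x\<close> would be a direction along which
  \<open>q\<close> becomes negative.\<close>

lemma self_adjoint_eigenvector:
  fixes f :: "'a::euclidean_space \<Rightarrow> 'a"
  assumes f: "linear f" and sa: "\<And>x y. f x \<bullet> y = x \<bullet> f y"
    and S: "subspace S" "f ` S \<subseteq> S" "S \<noteq> {0}"
  obtains x c where "x \<in> S" "norm x = 1" "f x = c *\<^sub>R x"
proof -
  interpret f: linear f by (rule f)
  have "0 \<in> S" using S(1) by (rule subspace_0)
  then obtain z where "z \<in> S" "z \<noteq> 0" using S(3) by auto
  then have ne: "z /\<^sub>R norm z \<in> sphere 0 1 \<inter> S" using S(1) by (simp add: subspace_scale)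
  have co: "compact (sphere 0 1 \<inter> S)" using S(1) by (simp add: closed_subspace compact_Int_closed)
  have "continuous_on (sphere 0 1 \<inter> S) (\<lambda>y. f y \<bullet> y)"
    by (intro continuous_intros linear_continuous_on linear_conv_bounded_linear[THEN iffD1] f)
  then have "\<exists>x\<in>sphere 0 1 \<inter> S. \<forall>y\<in>sphere 0 1 \<inter> S. f y \<bullet> y \<le> f x \<bullet> x"
    using continuous_attains_sup[OF co] ne by blast
  then obtain x where x: "x \<in> S" "norm x = 1"
    and xmax: "\<And>y. y \<in> S \<Longrightarrow> norm y = 1 \<Longrightarrow> f y \<bullet> y \<le> f x \<bullet> x"
    by auto
  define c where "c = f x \<bullet> x"
  define q where "q y = c * (y \<bullet> y) - f y \<bullet> y" for y
  have q_nonneg: "0 \<le> q y" if "y \<in> S" for y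
  proof (cases "y = 0")
    case False
    then have "f (y /\<^sub>R norm y) \<bullet> (y /\<^sub>R norm y) \<le> c"
      unfolding c_def using that S(1) by (intro xmax) (auto simp: subspace_scale)
    then have "(f y \<bullet> y) / (norm y)\<^sup>2 \<le> c"
      by (simp add: f.scaleR power2_eq_square divide_simps)
    then show ?thesis
      using False by (simp add: q_def divide_simps power2_norm_eq_inner)
  qed (simp add: q_def f.zero)
  define y where "y = c *\<^sub>R x - f x"
  have y: "y \<in> S" using x S by (auto simp: y_def subspace_diff subspace_scale)
  have qx: "q x = 0" using x by (simp add: q_def c_def flip: power2_norm_eq_inner)
  have expand: "q (x + t *\<^sub>R y) = 2 * t * (y \<bullet> y) + t\<^sup>2 * q y" for t
  proof -
    have "q (x + t *\<^sub>R y) = q x + 2 * t * (c * (x \<bullet> y) - f x \<bullet> y) + t\<^sup>2 * q y"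
      using sa[of y x]
      by (simp add: q_def f.add f.scaleR inner_add_left inner_add_right power2_eq_square
          algebra_simps inner_commute)
    also have "c * (x \<bullet> y) - f x \<bullet> y = y \<bullet> y"
      by (simp add: y_def inner_diff_left)
    finally show ?thesis by (simp add: qx)
  qed
  have "y \<bullet> y = 0"
  proof (rule ccontr)
    assume "y \<bullet> y \<noteq> 0"
    then have pos: "y \<bullet> y > 0" by simp
    \<comment> \<open>Adding 1 keeps the divisor in \<open>t\<close> positive even when
      \<open>q y = 0\<close>.\<close>
    define e where "e = q y + 1"
    have e: "e > 0" "q y = e - 1" using q_nonneg[OF y] by (simp_all add: e_def)
    define t where "t = - (y \<bullet> y) / e"
    have "0 \<le> q (x + t *\<^sub>R y)"
      by (rule q_nonneg[OF subspace_add[OF S(1) x(1) subspace_scale[OF S(1) y]]])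
    also have "\<dots> = (y \<bullet> y)\<^sup>2 / e\<^sup>2 * (- e - 1)"
      unfolding expand e(2) t_def using e(1) by (simp add: field_simps power2_eq_square)
    also have "\<dots> < 0"
      using pos e(1) by (intro mult_pos_neg) (simp_all add: zero_less_divide_iff)
    finally show False by simp
  qed
  then have "f x = c *\<^sub>R x" by (simp add: y_def)
  with x that show ?thesis by blast
qed

text \<open>Induction on the dimension of \<open>S\<close>: split off one unit eigenvector
  \<open>x\<close>. Self-adjointness makes the orthogonal complement of \<open>x\<close> in
  \<open>S\<close> invariant again.\<close>

lemma self_adjoint_eigenbasis:
  fixes f :: "'a::euclidean_space \<Rightarrow> 'a"
  assumes f: "linear f" and sa: "\<And>x y. f x \<bullet> y = x \<bullet> f y"
    and "subspace S" "f ` S \<subseteq> S"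
  shows "\<exists>B. B \<subseteq> S \<and> finite B \<and> card B = dim S \<and> orthonormal_on B (\<lambda>x. x) \<and> (\<forall>x\<in>B. \<exists>c. f x = c *\<^sub>R x)"
  using assms(3,4)
proof (induction "dim S" arbitrary: S)
  case 0
  then show ?case by (intro exI[of _ "{}"]) (auto simp: orthonormal_on_def)
next
  case (Suc n)
  then have "S \<noteq> {0}" by auto
  then obtain x c where x: "x \<in> S" "norm x = 1" "f x = c *\<^sub>R x"
    using self_adjoint_eigenvector[OF f sa Suc.prems] by metis
  define T where "T = {y \<in> S. \<forall>z\<in>span {x}. orthogonal z y}"
  have T_eq: "T = {y \<in> S. x \<bullet> y = 0}"
    by (auto simp: T_def orthogonal_def span_singleton)
  have "dim T + dim (span {x}) = dim S"
    unfolding T_def by (rule dim_subspace_orthogonal_to_vectors)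
      (use x Suc.prems in \<open>auto simp: span_minimal\<close>)
  moreover have "dim (span {x}) = 1" using x by (auto simp: dim_singleton)
  ultimately have dimT: "n = dim T" using Suc.hyps by simp
  have "subspace T"
    using Suc.prems(1) by (auto simp: T_eq subspace_def inner_add_right)
  moreover have "f ` T \<subseteq> T"
  proof -
    have "x \<bullet> f y = c * (x \<bullet> y)" for y using sa[of x y] x(3) by simp
    then show ?thesis using Suc.prems(2) by (auto simp: T_eq)
  qed
  ultimately obtain B where B: "B \<subseteq> T" "finite B" "card B = dim T"
    "orthonormal_on B (\<lambda>x. x)" "\<forall>x\<in>B. \<exists>c. f x = c *\<^sub>R x"
    using Suc.hyps(1)[OF dimT] by blast
  have xB: "x \<bullet> y = 0" if "y \<in> B" for y using B(1) that T_eq by auto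
  have xx: "x \<bullet> x = 1" using x(2) by (simp add: norm_eq_1)
  have "x \<notin> B" using xB xx by auto
  show ?case
  proof (intro exI[of _ "insert x B"] conjI)
    show "insert x B \<subseteq> S" using B(1) x(1) by (auto simp: T_def)
    show "card (insert x B) = dim S" using \<open>x \<notin> B\<close> B dimT Suc.hyps by simp
    show "orthonormal_on (insert x B) (\<lambda>x. x)"
      using B(4) xB xx \<open>x \<notin> B\<close> by (auto simp: orthonormal_on_def inner_commute)
  qed (use B x in auto)
qed

text \<open>The eigenvalues are put in decreasing order, which is the order in which
  \<open>sing_val\<close> lists them.\<close>

lemma self_adjoint_sorted_eigenbasis:
  fixes f :: "'a::euclidean_space \<Rightarrow> 'a"
  assumes "linear f" and "\<And>x y. f x \<bullet> y = x \<bullet> f y"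
  obtains v and \<mu> :: "nat \<Rightarrow> real"
  where "orthonormal_on {..<DIM('a)} v" "\<And>i. i < DIM('a) \<Longrightarrow> f (v i) = \<mu> i *\<^sub>R v i"
    "sorted (rev (map \<mu> [0..<DIM('a)]))"
proof -
  obtain B where B: "finite B" "card B = DIM('a)" "orthonormal_on B (\<lambda>x. x)"
    "\<forall>x\<in>B. \<exists>c. f x = c *\<^sub>R x"
    using self_adjoint_eigenbasis[OF assms, of UNIV] by auto
  then obtain c where c: "\<And>x. x \<in> B \<Longrightarrow> f x = c x *\<^sub>R x" by metis
  obtain xs where xs: "set xs = B" "distinct xs"
    using finite_distinct_list[OF B(1)] by blast
  define js where "js = rev (sort_key c xs)"
  have js: "set js = B" "distinct js" using xs by (simp_all add: js_def)
  then have len: "length js = DIM('a)" using B(2) distinct_card by metis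
  show ?thesis
  proof
    show "orthonormal_on {..<DIM('a)} ((!) js)"
      by (rule orthonormal_on_reindex[OF B(3)])
        (use js len in \<open>auto simp: inj_on_def nth_eq_iff_index_eq\<close>)
    show "f (js ! i) = c (js ! i) *\<^sub>R (js ! i)" if "i < DIM('a)" for i
      using that js len by (metis c nth_mem)
    have "map (\<lambda>i. c (js ! i)) [0..<DIM('a)] = map c js"
      by (rule nth_equalityI) (simp_all add: len)
    also have "rev \<dots> = map c (sort_key c xs)" by (simp add: js_def rev_map)
    finally show "sorted (rev (map (\<lambda>i. c (js ! i)) [0..<DIM('a)]))" by simp
  qed
qed

text \<open>The vectors of an orthonormal basis of the orthogonal complement are appended. This
  later supplies left singular vectors for the zero singular values, where \<open>X\<close> itself
  determines none.\<close>

lemma orthonormal_on_extend: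
  fixes u :: "nat \<Rightarrow> 'a::euclidean_space"
  assumes "orthonormal_on {..<r} u"
  obtains w where "orthonormal_on {..<DIM('a)} w" "\<And>i. i < r \<Longrightarrow> w i = u i"
proof -
  define T where "T = {y \<in> UNIV. \<forall>z\<in>span (u ` {..<r}). orthogonal z y}"
  have sT: "subspace T"
    by (auto simp: T_def subspace_def orthogonal_def inner_add_right)
  have "dim T + dim (span (u ` {..<r})) = DIM('a)"
    using dim_subspace_orthogonal_to_vectors[of "span (u ` {..<r})" "UNIV :: 'a set"]
    by (simp add: T_def)
  moreover have "dim (span (u ` {..<r})) = r"
    using assms by (simp add: dim_eq_card_independent orthonormal_on_independent card_image orthonormal_on_inj)
  ultimately have dT: "dim T + r = DIM('a)" by simp
  obtain B where B: "B \<subseteq> T" "pairwise orthogonal B" "\<And>x. x \<in> B \<Longrightarrow> norm x = 1"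
    "independent B" "card B = dim T" "span B = T"
    using orthonormal_basis_subspace[OF sT] by blast
  have "finite B" using B(4) independent_imp_finite by blast
  then obtain xs where xs: "set xs = B" "distinct xs" using finite_distinct_list by blast
  then have len: "length xs = dim T" using B(5) distinct_card by metis
  define w where "w i = (if i < r then u i else xs ! (i - r))" for i
  have xsT: "xs ! k \<in> B" if "k < dim T" for k using that xs len by (metis nth_mem)
  have ux: "u i \<bullet> xs ! k = 0" if "i < r" "k < dim T" for i k
  proof -
    have "u i \<in> span (u ` {..<r})" using that(1) by (intro span_base) auto
    then show ?thesis using xsT[OF that(2)] B(1) by (auto simp: T_def orthogonal_def)
  qed
  have xx: "xs ! k \<bullet> xs ! l = (if k = l then 1 else 0)" if "k < dim T" "l < dim T" for k l
  proof (cases "k = l")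
    case True then show ?thesis using B(3)[OF xsT[OF that(1)]] by (simp add: norm_eq_1)
  next
    case False
    then have "xs ! k \<noteq> xs ! l" using xs that len by (simp add: nth_eq_iff_index_eq)
    then show ?thesis using B(2) xsT that False by (simp add: pairwise_def orthogonal_def)
  qed
  have "orthonormal_on {..<DIM('a)} w"
    unfolding orthonormal_on_def
  proof (intro ballI)
    fix i j assume "i \<in> {..<DIM('a)}" "j \<in> {..<DIM('a)}"
    then have ij: "\<not> i < r \<Longrightarrow> i - r < dim T" "\<not> j < r \<Longrightarrow> j - r < dim T" using dT by auto
    consider "i < r" "j < r" | "i < r" "\<not> j < r" | "\<not> i < r" "j < r" | "\<not> i < r" "\<not> j < r"
      by blast
    then show "w i \<bullet> w j = (if i = j then 1 else 0)"
    proof cases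
      case 1
      then show ?thesis using orthonormal_onD[OF assms, of i j] by (simp add: w_def)
    next
      case 2
      then show ?thesis using ux[OF 2(1) ij(2)] by (auto simp: w_def)
    next
      case 3
      then show ?thesis using ux[OF 3(2) ij(1)] by (auto simp: w_def inner_commute)
    next
      case 4
      then have "i - r = j - r \<longleftrightarrow> i = j" by auto
      with 4 show ?thesis using xx[OF ij] by (simp add: w_def)
    qed
  qed
  with that show ?thesis by (simp add: w_def)
qed

section \<open>Sums of rank-one matrices\<close>

definition outer :: "real^'n1 \<Rightarrow> real^'n2 \<Rightarrow> real^'n2^'n1" where
  "outer u v = (\<chi> k l. u $ k * v $ l)"

lemma inner_outer: "outer u v \<bullet> outer u' v' = (u \<bullet> u') * (v \<bullet> v')"
  by (simp add: outer_def inner_vec_def sum_product mult_ac) (subst sum.swap, rule refl)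

lemma outer_scaleR_left: "outer (c *\<^sub>R u) v = c *\<^sub>R outer u v"
  by (simp add: outer_def vec_eq_iff)

lemma outer_zero_left [simp]: "outer 0 v = 0"
  by (simp add: outer_def vec_eq_iff)

text \<open>Working form of a singular value decomposition: \<open>u\<close> and \<open>v\<close>
  are kept while the coefficients \<open>d\<close> vary, so thresholded matrices and subgradients
  share the singular vectors of \<open>X\<close>.\<close>

definition svd_sum :: "nat \<Rightarrow> (nat \<Rightarrow> real) \<Rightarrow> (nat \<Rightarrow> real^'n1) \<Rightarrow> (nat \<Rightarrow> real^'n2) \<Rightarrow> real^'n2^'n1" where
  "svd_sum m d u v = (\<Sum>i<m. d i *\<^sub>R outer (u i) (v i))"

lemma svd_sum_diff: "svd_sum m d u v - svd_sum m e u v = svd_sum m (\<lambda>i. d i - e i) u v"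
  by (simp add: svd_sum_def scaleR_left_diff_distrib sum_subtractf)

lemma svd_sum_scale: "c *\<^sub>R svd_sum m d u v = svd_sum m (\<lambda>i. c * d i) u v"
  by (simp add: svd_sum_def scaleR_sum_right)

lemma inner_svd_sum:
  "svd_sum m g u v \<bullet> svd_sum m s u' v' =
     (\<Sum>i<m. \<Sum>j<m. g i * s j * ((u i \<bullet> u' j) * (v i \<bullet> v' j)))"
  by (simp add: svd_sum_def inner_sum_left inner_sum_right inner_outer mult_ac sum_distrib_left)
     (subst sum.swap, rule refl)

lemma inner_svd_sum_same:
  assumes "orthonormal_on {..<m} u" "orthonormal_on {..<m} v"
  shows "svd_sum m g u v \<bullet> svd_sum m s u v = (\<Sum>i<m. g i * s i)"
  unfolding inner_svd_sum
proof (intro sum.cong refl)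
  fix i assume i: "i \<in> {..<m}"
  have "(\<Sum>j<m. g i * s j * ((u i \<bullet> u j) * (v i \<bullet> v j))) = (\<Sum>j<m. if j = i then g i * s j else 0)"
    by (intro sum.cong refl) (use i in \<open>auto simp: orthonormal_onD[OF assms(1)] orthonormal_onD[OF assms(2)]\<close>)
  then show "(\<Sum>j<m. g i * s j * ((u i \<bullet> u j) * (v i \<bullet> v j))) = g i * s i"
    using i by simp
qed

text \<open>The numbers \<open>(u i \<bullet> u' j) * (v i \<bullet> v' j)\<close> are dominated by a doubly substochastic matrix, so
  a Young-type bound on the products \<open>g i * s j\<close> passes to the inner product. This replaces the
  von Neumann trace inequality, and no ordering of \<open>g\<close> or \<open>s\<close> is needed.\<close>

lemma inner_svd_sum_le:
  assumes u: "orthonormal_on {..<m} u" and v: "orthonormal_on {..<m} v"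
    and u': "orthonormal_on {..<m} u'" and v': "orthonormal_on {..<m} v'"
    and nonneg: "\<And>i j. i < m \<Longrightarrow> j < m \<Longrightarrow> 0 \<le> g i * s j"
    and young: "\<And>i j. i < m \<Longrightarrow> j < m \<Longrightarrow> g i * s j \<le> a i + c j"
    and ac: "\<And>i. i < m \<Longrightarrow> 0 \<le> a i" "\<And>i. i < m \<Longrightarrow> 0 \<le> c i"
  shows "svd_sum m g u v \<bullet> svd_sum m s u' v' \<le> (\<Sum>i<m. a i) + (\<Sum>j<m. c j)"
proof -
  \<comment> \<open>By the arithmetic-geometric mean inequality \<open>P\<close> dominates the
    products, and Bessel's inequality for the four families bounds its row and column sums by 1. As
    these sums may be smaller than 1, the final estimate uses that \<open>a\<close> and
    \<open>c\<close> are nonnegative.\<close>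
  define P where "P i j = ((u i \<bullet> u' j)\<^sup>2 + (v i \<bullet> v' j)\<^sup>2) / 2" for i j
  have le_P: "(u i \<bullet> u' j) * (v i \<bullet> v' j) \<le> P i j" for i j
    using sum_squares_bound[of "u i \<bullet> u' j" "v i \<bullet> v' j"] by (simp add: P_def)
  have P0: "0 \<le> P i j" for i j by (simp add: P_def)
  have row: "(\<Sum>j<m. P i j) \<le> 1" if "i < m" for i
  proof -
    have "(\<Sum>j<m. (u i \<bullet> u' j)\<^sup>2) \<le> 1" "(\<Sum>j<m. (v i \<bullet> v' j)\<^sup>2) \<le> 1"
      using bessel_inequality[OF u', of "u i"] bessel_inequality[OF v', of "v i"]
        orthonormal_onD[OF u, of i i] orthonormal_onD[OF v, of i i] that
      by (simp_all add: inner_commute power2_norm_eq_inner)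
    then show ?thesis by (simp add: P_def sum.distrib flip: sum_divide_distrib)
  qed
  have col: "(\<Sum>i<m. P i j) \<le> 1" if "j < m" for j
  proof -
    have "(\<Sum>i<m. (u i \<bullet> u' j)\<^sup>2) \<le> 1" "(\<Sum>i<m. (v i \<bullet> v' j)\<^sup>2) \<le> 1"
      using bessel_inequality[OF u, of "u' j"] bessel_inequality[OF v, of "v' j"]
        orthonormal_onD[OF u', of j j] orthonormal_onD[OF v', of j j] that
      by (simp_all add: power2_norm_eq_inner)
    then show ?thesis by (simp add: P_def sum.distrib flip: sum_divide_distrib)
  qed
  have "svd_sum m g u v \<bullet> svd_sum m s u' v' \<le> (\<Sum>i<m. \<Sum>j<m. (a i + c j) * P i j)"
    unfolding inner_svd_sum
  proof (intro sum_mono)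
    fix i j assume "i \<in> {..<m}" "j \<in> {..<m}"
    then have ij: "i < m" "j < m" by auto
    have "g i * s j * ((u i \<bullet> u' j) * (v i \<bullet> v' j)) \<le> g i * s j * P i j"
      by (rule mult_left_mono[OF le_P nonneg[OF ij]])
    also have "\<dots> \<le> (a i + c j) * P i j"
      by (rule mult_right_mono[OF young[OF ij] P0])
    finally show "g i * s j * ((u i \<bullet> u' j) * (v i \<bullet> v' j)) \<le> (a i + c j) * P i j" .
  qed
  also have "\<dots> = (\<Sum>i<m. a i * (\<Sum>j<m. P i j)) + (\<Sum>i<m. \<Sum>j<m. c j * P i j)"
    by (simp add: distrib_right sum.distrib sum_distrib_left)
  also have "(\<Sum>i<m. \<Sum>j<m. c j * P i j) = (\<Sum>j<m. c j * (\<Sum>i<m. P i j))"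
    by (subst sum.swap) (simp add: sum_distrib_left)
  also have "(\<Sum>i<m. a i * (\<Sum>j<m. P i j)) + \<dots> \<le> (\<Sum>i<m. a i) + (\<Sum>j<m. c j)"
    by (intro add_mono sum_mono mult_left_le row col ac) auto
  finally show ?thesis .
qed

section \<open>Existence of singular value decompositions\<close>

lemma bij_betw_to_nat_on_UNIV: "bij_betw (to_nat_on (UNIV :: 'n::finite set)) UNIV {..<CARD('n)}"
  using to_nat_on_finite[of "UNIV :: 'n set"] by simp

lemma to_nat_on_UNIV_eq_iff [simp]:
  "to_nat_on UNIV (i :: 'n::finite) = to_nat_on UNIV j \<longleftrightarrow> i = j"
  using bij_betw_imp_inj_on[OF bij_betw_to_nat_on_UNIV] by (rule inj_eq)

lemma to_nat_on_UNIV_less: "to_nat_on UNIV (i :: 'n::finite) < CARD('n)"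
  using bij_betwE[OF bij_betw_to_nat_on_UNIV] by auto

lemma sum_to_nat_on: "(\<Sum>j\<in>(UNIV :: 'n::finite set). f (to_nat_on UNIV j)) = (\<Sum>i<CARD('n). f i)"
  by (rule sum.reindex_bij_betw[OF bij_betw_to_nat_on_UNIV])

text \<open>The numbering of columns is that of \<open>rect_diag\<close>, so matrix products turn
  into sums over natural number indices.\<close>

definition columns_matrix :: "(nat \<Rightarrow> real^'m) \<Rightarrow> real^'n^'m" where
  "columns_matrix u = (\<chi> k j. u (to_nat_on UNIV j) $ k)"

lemma columns_matrix_cong:
  "(\<And>i. i < CARD('n) \<Longrightarrow> u i = w i) \<Longrightarrow> columns_matrix u = (columns_matrix w :: real^'n^'m)"
  by (simp add: columns_matrix_def to_nat_on_UNIV_less)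

lemma matrix_mult_columns_matrix: "M ** columns_matrix u = columns_matrix (\<lambda>i. M *v u i)"
  by (simp add: columns_matrix_def matrix_matrix_mult_def matrix_vector_mult_def vec_eq_iff)

lemma columns_matrix_mult_transpose:
  "(columns_matrix u :: real^'n^'m) ** transpose (columns_matrix v :: real^'n^'k)
     = (\<Sum>i<CARD('n). outer (u i) (v i))"
  by (simp add: vec_eq_iff columns_matrix_def matrix_matrix_mult_def transpose_def outer_def
      sum_to_nat_on[where f = "\<lambda>i. u i $ _ * v i $ _"])

lemma orthogonal_columns_matrix:
  "orthogonal_matrix (columns_matrix u :: real^'n^'n) \<longleftrightarrow> orthonormal_on {..<CARD('n)} u"
proof -
  have "(transpose (columns_matrix u) ** columns_matrix u :: real^'n^'n) $ i $ j
      = u (to_nat_on UNIV i) \<bullet> u (to_nat_on UNIV j)" for i j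
    by (simp add: columns_matrix_def matrix_matrix_mult_def transpose_def inner_vec_def)
  then have "orthogonal_matrix (columns_matrix u :: real^'n^'n) \<longleftrightarrow>
      (\<forall>i j :: 'n. u (to_nat_on UNIV i) \<bullet> u (to_nat_on UNIV j) = (if i = j then 1 else 0))"
    by (simp add: orthogonal_matrix vec_eq_iff mat_def)
  also have "\<dots> \<longleftrightarrow> orthonormal_on (range (to_nat_on (UNIV :: 'n set))) u"
    by (simp add: orthonormal_on_def)
  also have "range (to_nat_on (UNIV :: 'n set)) = {..<CARD('n)}"
    using bij_betw_to_nat_on_UNIV by (rule bij_betw_imp_surj_on)
  finally show ?thesis .
qed

lemma columns_matrix_exhaust:
  fixes U :: "real^'n^'m"
  obtains u where "U = columns_matrix u"
proof
  show "U = columns_matrix (\<lambda>i. column (inv (to_nat_on UNIV) i) U)"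
    by (simp add: columns_matrix_def column_def vec_eq_iff inv_f_f inj_def)
qed

text \<open>The zero branch concerns matrices with more columns than rows: the surplus columns meet
  no diagonal entry.\<close>

lemma columns_matrix_mult_rect_diag:
  "(columns_matrix u :: real^'n1^'n1) ** (rect_diag d :: real^'n2^'n1)
     = columns_matrix (\<lambda>i. if i < CARD('n1) then d i *\<^sub>R u i else 0)"
proof -
  have "(\<Sum>l\<in>UNIV. u (to_nat_on UNIV l) $ k * (if to_nat_on UNIV (l::'n1) = p then d (to_nat_on UNIV l) else 0))
      = (\<Sum>i<CARD('n1). u i $ k * (if i = p then d i else 0))" for k p
    by (rule sum_to_nat_on)
  also have "\<dots> k p = (if p < CARD('n1) then d p * u p $ k else 0)" for k p
    by (simp add: if_distrib cong: if_cong)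
  finally show ?thesis
    by (simp add: vec_eq_iff columns_matrix_def matrix_matrix_mult_def rect_diag_def)
qed

lemma columns_matrix_rect_diag_columns_matrix:
  "(columns_matrix u :: real^'n1^'n1) ** rect_diag d ** transpose (columns_matrix v :: real^'n2^'n2)
     = svd_sum (min CARD('n1) CARD('n2)) d u v"
proof -
  have "(\<Sum>i<CARD('n2). outer (if i < CARD('n1) then d i *\<^sub>R u i else 0) (v i))
      = (\<Sum>i\<in>{..<CARD('n2)} \<inter> {..<CARD('n1)}. d i *\<^sub>R outer (u i) (v i))"
    by (subst sum.inter_restrict) (auto simp: outer_scaleR_left intro!: sum.cong)
  also have "{..<CARD('n2)} \<inter> {..<CARD('n1)} = {..<min CARD('n1) CARD('n2)}" by auto
  finally show ?thesis
    by (simp add: columns_matrix_mult_rect_diag columns_matrix_mult_transpose svd_sum_def)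
qed

section \<open>Singular values from an eigenbasis, and the decomposition itself\<close>

lemma poly_charpoly: "poly (charpoly A) x = det (mat x - A)"
  by (auto simp: charpoly_def det_def poly_sum poly_prod mat_def map_matrix_def intro!: sum.cong prod.cong)

text \<open>The orthogonal matrix of eigenvectors diagonalises \<open>mat x - A\<close> for every
  real \<open>x\<close>. Both polynomials thus agree as functions, hence as polynomials.\<close>

lemma charpoly_eigenbasis:
  fixes A :: "real^'n^'n"
  assumes v: "orthonormal_on {..<CARD('n)} v" and eig: "\<And>i. i < CARD('n) \<Longrightarrow> A *v v i = \<mu> i *\<^sub>R v i"
  shows "charpoly A = (\<Prod>i<CARD('n). [:- \<mu> i, 1:])"
proof -
  let ?V = "columns_matrix v :: real^'n^'n"
  have V: "orthogonal_matrix ?V" using v by (simp add: orthogonal_columns_matrix)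
  then have detV: "det ?V \<noteq> 0" using det_orthogonal_matrix[of ?V] by auto
  have "det (mat x - A) = (\<Prod>i<CARD('n). x - \<mu> i)" for x
  proof -
    let ?D = "rect_diag (\<lambda>i. x - \<mu> i) :: real^'n^'n"
    have "(mat x - A) *v y = x *\<^sub>R y - A *v y" for y
      by (simp add: matrix_vector_mult_diff_rdistrib)
         (simp add: vec_eq_iff matrix_vector_mult_def mat_def if_distrib if_distribR cong: if_cong)
    then have "(mat x - A) ** ?V = ?V ** ?D"
      by (auto simp: matrix_mult_columns_matrix columns_matrix_mult_rect_diag eig scaleR_left_diff_distrib
          intro!: columns_matrix_cong)
    then have "det (mat x - A) * det ?V = det ?V * det ?D"
      by (metis det_mul)
    then have "det (mat x - A) = det ?D" using detV by simp
    also have "\<dots> = (\<Prod>i\<in>UNIV. ?D $ i $ i)"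
    proof (rule det_diagonal)
      show "?D $ i $ j = 0" if "i \<noteq> j" for i j
        using that by (simp add: rect_diag_def)
    qed
    also have "\<dots> = (\<Prod>i\<in>(UNIV::'n set). x - \<mu> (to_nat_on UNIV i))" by (simp add: rect_diag_def)
    also have "\<dots> = (\<Prod>i<CARD('n). x - \<mu> i)"
      by (rule prod.reindex_bij_betw[OF bij_betw_to_nat_on_UNIV])
    finally show ?thesis .
  qed
  then have "poly (charpoly A) = poly (\<Prod>i<CARD('n). [:- \<mu> i, 1:])"
    by (auto simp: fun_eq_iff poly_charpoly poly_prod)
  then show ?thesis by (simp add: poly_eq_poly_eq_iff)
qed

text \<open>The roots of the characteristic polynomial form the multiset of the numbers
  \<open>\<mu> i\<close>. As these are already decreasing, sorting and reversing returns them in the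
  given order.\<close>

lemma sing_val_eigenbasis:
  fixes X :: "real^'n2^'n1"
  assumes "orthonormal_on {..<CARD('n2)} v"
    and "\<And>i. i < CARD('n2) \<Longrightarrow> (transpose X ** X) *v v i = \<mu> i *\<^sub>R v i"
    and sorted: "sorted (rev (map \<mu> [0..<CARD('n2)]))" and i: "i < CARD('n2)"
  shows "sing_val X i = sqrt (\<mu> i)"
proof -
  have "charpoly (transpose X ** X) = (\<Prod>i<CARD('n2). [:- \<mu> i, 1:])"
    by (rule charpoly_eigenbasis[OF assms(1,2)])
  then have "proots (charpoly (transpose X ** X)) = (\<Sum>i<CARD('n2). {#\<mu> i#})"
    by (simp add: proots_prod)
  also have "\<dots> = mset (map \<mu> [0..<CARD('n2)])"
    by (simp add: sum_unfold_sum_mset atLeast0LessThan mset_map)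
  finally have "sorted_list_of_multiset (proots (charpoly (transpose X ** X))) = sort (map \<mu> [0..<CARD('n2)])"
    by (simp only: sorted_list_of_multiset_mset)
  also have "\<dots> = rev (map \<mu> [0..<CARD('n2)])"
    using sorted by (intro properties_for_sort) simp_all
  finally show ?thesis using i by (simp add: sing_val_def)
qed

lemma matrix_eq_sum_outer:
  fixes X :: "real^'n2^'n1"
  assumes "orthonormal_on {..<CARD('n2)} v"
  shows "X = (\<Sum>i<CARD('n2). outer (X *v v i) (v i))"
proof -
  let ?V = "columns_matrix v :: real^'n2^'n2"
  have "?V ** transpose ?V = mat 1"
    using assms by (simp add: orthogonal_matrix_def flip: orthogonal_columns_matrix)
  then have "X = X ** ?V ** transpose ?V" by (simp flip: matrix_mul_assoc)
  then show ?thesis by (simp add: matrix_mult_columns_matrix columns_matrix_mult_transpose)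
qed

text \<open>Take an eigenbasis \<open>v\<close> of \<open>transpose X ** X\<close> with eigenvalues
  \<open>\<mu>\<close>. The vectors \<open>X *v v i\<close> are orthogonal with squared norms
  \<open>\<mu> i\<close>, so the eigenvalues are nonnegative; normalising the nonzero vectors and
  completing them to a basis gives the left singular vectors.\<close>

lemma
  fixes X :: "real^'n2^'n1"
  shows svd_exists: "\<exists>U V. is_svd X U V" and sing_val_nonneg: "i < min CARD('n1) CARD('n2) \<Longrightarrow> 0 \<le> sing_val X i"
proof -
  let ?n1 = "CARD('n1)" and ?n2 = "CARD('n2)"
  have XX: "(transpose X ** X *v x) \<bullet> y = (X *v x) \<bullet> (X *v y)" for x y
    by (metis dot_lmul_matrix inner_commute matrix_vector_mul_assoc transpose_matrix_vector vector_transpose_matrix)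
  have sa: "(transpose X ** X *v x) \<bullet> y = x \<bullet> (transpose X ** X *v y)" for x y
    using XX[of x y] XX[of y x] by (simp add: inner_commute)
  have "linear ((*v) (transpose X ** X))" by simp
  then obtain v \<mu> where v: "orthonormal_on {..<?n2} v"
    and eig: "\<And>i. i < ?n2 \<Longrightarrow> transpose X ** X *v v i = \<mu> i *\<^sub>R v i"
    and sorted: "sorted (rev (map \<mu> [0..<?n2]))"
    using self_adjoint_sorted_eigenbasis[OF _ sa] by (auto simp: DIM_cart)
  have gram: "(X *v v i) \<bullet> (X *v v j) = (if i = j then \<mu> i else 0)" if "i < ?n2" "j < ?n2" for i j
    using that XX[of "v i" "v j"] orthonormal_onD[OF v, of i j] by (cases "i = j") (simp_all add: eig)
  have \<mu>0: "0 \<le> \<mu> i" if "i < ?n2" for i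
    using gram[OF that that] by (metis inner_ge_zero)
  have sv: "sing_val X i = sqrt (\<mu> i)" if "i < ?n2" for i
    by (rule sing_val_eigenbasis[OF v eig sorted that])
  show "0 \<le> sing_val X i" if "i < min ?n1 ?n2" for i
    using that sv \<mu>0 by simp
  \<comment> \<open>\<open>r\<close> is the number of positive eigenvalues, that is, the rank of
    \<open>X\<close>. The alternative \<open>i = ?n2\<close> keeps \<open>LEAST\<close> meaningful
    when no eigenvalue vanishes.\<close>
  define r where "r = (LEAST i. i = ?n2 \<or> \<mu> i = 0)"
  have r: "r = ?n2 \<or> \<mu> r = 0" unfolding r_def by (rule LeastI[of _ ?n2]) simp
  have r_le: "r \<le> ?n2" unfolding r_def by (rule Least_le) simp
  have below: "\<mu> i > 0" if "i < r" for i
    using not_less_Least[of i "\<lambda>i. i = ?n2 \<or> \<mu> i = 0"] that \<mu>0[of i] r_le by (auto simp: r_def)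
  have above: "\<mu> i = 0" if "r \<le> i" "i < ?n2" for i
  proof -
    have "\<mu> i \<le> \<mu> r"
      using sorted_rev_nth_mono[OF sorted, of r i] that by simp
    then show ?thesis using r that \<mu>0[of i] by auto
  qed
  have "orthonormal_on {..<r} (\<lambda>i. (X *v v i) /\<^sub>R sqrt (\<mu> i))"
    unfolding orthonormal_on_def
  proof (intro ballI)
    fix i j assume "i \<in> {..<r}" "j \<in> {..<r}"
    then show "((X *v v i) /\<^sub>R sqrt (\<mu> i)) \<bullet> ((X *v v j) /\<^sub>R sqrt (\<mu> j)) = (if i = j then 1 else 0)"
      using gram[of i j] below[of i] r_le by (auto simp: field_simps)
  qed
  \<comment> \<open>An orthonormal family of \<open>r\<close> vectors in a space of dimension
    \<open>?n1\<close> forces \<open>r \<le> ?n1\<close>, so every positive singular value has a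
    place on the diagonal.\<close>
  note this = this orthonormal_on_card_le[OF this]
  then obtain u where u: "orthonormal_on {..<?n1} u"
    and ui: "\<And>i. i < r \<Longrightarrow> u i = (X *v v i) /\<^sub>R sqrt (\<mu> i)" and rn1: "r \<le> ?n1"
    using orthonormal_on_extend[of r "\<lambda>i. (X *v v i) /\<^sub>R sqrt (\<mu> i)"] by (auto simp: DIM_cart)
  have Xv: "X *v v i = (if i < ?n1 then sing_val X i *\<^sub>R u i else 0)" if "i < ?n2" for i
  proof (cases "i < r")
    case True
    then show ?thesis using that ui below[of i] sv rn1 by simp
  next
    case False
    then have "\<mu> i = 0" using above that by simp
    then show ?thesis using gram[OF that that] sv[OF that] by simp
  qed
  have "X = (\<Sum>i<?n2. outer (X *v v i) (v i))" by (rule matrix_eq_sum_outer[OF v])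
  also have "\<dots> = (\<Sum>i<?n2. outer (if i < ?n1 then sing_val X i *\<^sub>R u i else 0) (v i))"
    using Xv by simp
  also have "\<dots> = (columns_matrix u :: real^'n1^'n1) ** rect_diag (sing_val X)
      ** transpose (columns_matrix v :: real^'n2^'n2)"
    by (simp add: columns_matrix_mult_rect_diag columns_matrix_mult_transpose)
  finally have "is_svd X (columns_matrix u) (columns_matrix v)"
    using u v by (simp add: is_svd_def orthogonal_columns_matrix)
  then show "\<exists>U V. is_svd X U V" by blast
qed

text \<open>A single pair \<open>u\<close>, \<open>v\<close> serves all diagonals \<open>d\<close>,
  which lets \<open>X\<close> and its soft-thresholding be compared coefficientwise.\<close>

lemma is_svd_svd_sum:
  fixes X :: "real^'n2^'n1"
  assumes "is_svd X U V"
  obtains u v where "orthonormal_on {..<min CARD('n1) CARD('n2)} u" "orthonormal_on {..<min CARD('n1) CARD('n2)} v"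
    "\<And>d. U ** rect_diag d ** transpose V = svd_sum (min CARD('n1) CARD('n2)) d u v"
proof -
  obtain u where u: "U = columns_matrix u" by (rule columns_matrix_exhaust)
  obtain v where v: "V = columns_matrix v" by (rule columns_matrix_exhaust)
  have "orthonormal_on {..<CARD('n1)} u" "orthonormal_on {..<CARD('n2)} v"
    using assms by (auto simp: is_svd_def u v orthogonal_columns_matrix)
  then have "orthonormal_on {..<min CARD('n1) CARD('n2)} u" "orthonormal_on {..<min CARD('n1) CARD('n2)} v"
    by (auto elim: orthonormal_on_subset)
  then show ?thesis
    by (rule that) (simp add: u v columns_matrix_rect_diag_columns_matrix)
qed

lemma svd_sum_exists:
  fixes X :: "real^'n2^'n1"
  obtains u v where "orthonormal_on {..<min CARD('n1) CARD('n2)} u" "orthonormal_on {..<min CARD('n1) CARD('n2)} v"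
    "X = svd_sum (min CARD('n1) CARD('n2)) (sing_val X) u v"
proof -
  obtain U V where UV: "is_svd X U V" using svd_exists by blast
  then have "X = U ** rect_diag (sing_val X) ** transpose V" by (simp add: is_svd_def)
  with is_svd_svd_sum[OF UV] that show ?thesis by metis
qed

section \<open>The nuclear norm\<close>

lemma nuclear_norm_eq_sum:
  "nuclear_norm (X :: real^'n2^'n1) = (\<Sum>i<min CARD('n1) CARD('n2). sing_val X i)"
  by (simp add: nuclear_norm_def rank_bound_def)

lemma norm_svd_sum:
  assumes "orthonormal_on {..<m} u" "orthonormal_on {..<m} v"
  shows "norm (svd_sum m d u v) = L2_set d {..<m}"
  by (simp add: norm_eq_sqrt_inner inner_svd_sum_same[OF assms] L2_set_def power2_eq_square)

text \<open>Duality between the spectral and the nuclear norm: coefficients in the interval from 0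
  to \<open>c\<close> give a matrix of spectral norm at most \<open>c\<close>.\<close>

lemma inner_svd_sum_le_nuclear_norm:
  fixes Y :: "real^'n2^'n1"
  defines "m \<equiv> min CARD('n1) CARD('n2)"
  assumes uv: "orthonormal_on {..<m} u" "orthonormal_on {..<m} v"
    and g: "\<And>i. i < m \<Longrightarrow> 0 \<le> g i" "\<And>i. i < m \<Longrightarrow> g i \<le> c"
  shows "svd_sum m g u v \<bullet> Y \<le> c * nuclear_norm Y"
proof -
  obtain u' v' where uv': "orthonormal_on {..<m} u'" "orthonormal_on {..<m} v'"
    and Y: "Y = svd_sum m (sing_val Y) u' v'"
    unfolding m_def by (rule svd_sum_exists)
  have Y0: "0 \<le> sing_val Y j" if "j < m" for j
    using that by (simp add: m_def sing_val_nonneg)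
  have "svd_sum m g u v \<bullet> svd_sum m (sing_val Y) u' v' \<le> (\<Sum>i<m. 0) + (\<Sum>j<m. c * sing_val Y j)"
    by (rule inner_svd_sum_le[OF uv uv'])
      (use g Y0 in \<open>auto intro!: mult_nonneg_nonneg mult_right_mono intro: order_trans\<close>)
  then show ?thesis
    by (simp add: nuclear_norm_eq_sum sum_distrib_left flip: Y m_def)
qed

text \<open>The coefficients \<open>d\<close> may be unsorted, so they are not compared with
  \<open>sing_val\<close> entry by entry. Instead each side is the pairing of the matrix with a sum
  of unit coefficients over its own decomposition, and pairing it with the unit sum of the other
  decomposition bounds one side by the other.\<close>

lemma nuclear_norm_svd_sum:
  fixes u :: "nat \<Rightarrow> real^'n1" and v :: "nat \<Rightarrow> real^'n2"
  defines "m \<equiv> min CARD('n1) CARD('n2)"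
  assumes uv: "orthonormal_on {..<m} u" "orthonormal_on {..<m} v"
    and d: "\<And>i. i < m \<Longrightarrow> 0 \<le> d i"
  shows "nuclear_norm (svd_sum m d u v) = (\<Sum>i<m. d i)"
proof (rule antisym)
  let ?Y = "svd_sum m d u v"
  obtain u' v' where uv': "orthonormal_on {..<m} u'" "orthonormal_on {..<m} v'"
    and Y: "?Y = svd_sum m (sing_val ?Y) u' v'"
    unfolding m_def by (rule svd_sum_exists)
  have "nuclear_norm ?Y = svd_sum m (\<lambda>i. 1) u' v' \<bullet> svd_sum m (sing_val ?Y) u' v'"
    unfolding inner_svd_sum_same[OF uv'] by (simp add: nuclear_norm_eq_sum m_def)
  also have "\<dots> = svd_sum m (\<lambda>i. 1) u' v' \<bullet> ?Y" by (rule arg_cong[OF Y[symmetric]])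
  also have "\<dots> \<le> (\<Sum>i<m. 0) + (\<Sum>j<m. d j)"
    by (rule inner_svd_sum_le[OF uv' uv]) (use d in auto)
  finally show "nuclear_norm ?Y \<le> (\<Sum>i<m. d i)" by simp
  have "(\<Sum>i<m. d i) = svd_sum m (\<lambda>i. 1) u v \<bullet> ?Y"
    by (simp add: inner_svd_sum_same[OF uv])
  also have "\<dots> \<le> 1 * nuclear_norm ?Y"
    using uv unfolding m_def by (intro inner_svd_sum_le_nuclear_norm) auto
  finally show "(\<Sum>i<m. d i) \<le> nuclear_norm ?Y" by simp
qed

text \<open>The unit-coefficient matrix \<open>?J\<close> built from \<open>X\<close> attains the
  nuclear norm at \<open>X\<close> and stays below it at \<open>Y\<close>. The constant is the
  Frobenius norm of \<open>?J\<close>.\<close>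

lemma nuclear_norm_lipschitz:
  fixes X Y :: "real^'n2^'n1"
  shows "nuclear_norm X - nuclear_norm Y \<le> sqrt (min CARD('n1) CARD('n2)) * norm (X - Y)"
proof -
  let ?m = "min CARD('n1) CARD('n2)"
  obtain u v where uv: "orthonormal_on {..<?m} u" "orthonormal_on {..<?m} v"
    and X: "X = svd_sum ?m (sing_val X) u v"
    by (rule svd_sum_exists)
  let ?J = "svd_sum ?m (\<lambda>i. 1) u v"
  have "nuclear_norm X = ?J \<bullet> svd_sum ?m (sing_val X) u v"
    by (simp add: inner_svd_sum_same[OF uv] nuclear_norm_eq_sum)
  also have "\<dots> = ?J \<bullet> (X - Y) + ?J \<bullet> Y"
    by (simp add: inner_diff_right flip: X)
  also have "?J \<bullet> (X - Y) \<le> norm ?J * norm (X - Y)"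
    by (rule norm_cauchy_schwarz)
  also have "norm ?J = sqrt ?m"
    by (simp add: norm_svd_sum[OF uv] L2_set_def)
  also have "?J \<bullet> Y \<le> 1 * nuclear_norm Y"
    by (rule inner_svd_sum_le_nuclear_norm[OF uv]) auto
  finally show ?thesis by simp
qed

lemma continuous_nuclear_norm: "isCont nuclear_norm (X :: real^'n2^'n1)"
proof -
  let ?c = "sqrt (min CARD('n1) CARD('n2))"
  have "norm (nuclear_norm Y - nuclear_norm X) \<le> ?c * norm (Y - X)" for Y :: "real^'n2^'n1"
    using nuclear_norm_lipschitz[of X Y] nuclear_norm_lipschitz[of Y X]
    by (simp add: norm_minus_commute)
  then have bound: "\<forall>\<^sub>F Y in at X. norm (nuclear_norm Y - nuclear_norm X) \<le> ?c * norm (Y - X)"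
    by (intro always_eventually) blast
  have "((\<lambda>Y. ?c * norm (Y - X)) \<longlongrightarrow> ?c * norm (X - X)) (at X)"
    by (intro tendsto_intros)
  then have "((\<lambda>Y. ?c * norm (Y - X)) \<longlongrightarrow> 0) (at X)" by simp
  with bound have "((\<lambda>Y. nuclear_norm Y - nuclear_norm X) \<longlongrightarrow> 0) (at X)"
    by (rule Lim_null_comparison)
  then show ?thesis by (simp add: isCont_def LIM_zero_iff)
qed

lemma norm_le_nuclear_norm:
  fixes X :: "real^'n2^'n1"
  shows "norm X \<le> nuclear_norm X"
proof -
  let ?m = "min CARD('n1) CARD('n2)"
  obtain u v where uv: "orthonormal_on {..<?m} u" "orthonormal_on {..<?m} v"
    and X: "X = svd_sum ?m (sing_val X) u v"
    by (rule svd_sum_exists)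
  have "norm X = L2_set (sing_val X) {..<?m}"
    by (subst X) (rule norm_svd_sum[OF uv])
  also have "\<dots> \<le> nuclear_norm X"
    unfolding nuclear_norm_eq_sum by (intro L2_set_le_sum sing_val_nonneg) auto
  finally show ?thesis .
qed

text \<open>The coefficients of \<open>X - Z\<close> are the minima of the singular values and
  \<open>\<tau>\<close>. They lie between 0 and \<open>\<tau>\<close>, so duality bounds the pairing
  with \<open>Y\<close>; they equal \<open>\<tau>\<close> wherever \<open>Z\<close> has a nonzero
  coefficient, so the pairing with \<open>Z\<close> is exactly
  \<open>\<tau> * nuclear_norm Z\<close>.\<close>

lemma soft_threshold_subgradient:
  fixes X Y :: "real^'n2^'n1"
  assumes "0 \<le> \<tau>"
  defines "Z \<equiv> soft_threshold \<tau> X"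
  shows "(X - Z) \<bullet> (Y - Z) \<le> \<tau> * nuclear_norm Y - \<tau> * nuclear_norm Z"
proof -
  let ?m = "min CARD('n1) CARD('n2)"
  let ?\<sigma> = "sing_val X" and ?d = "\<lambda>i. max (sing_val X i - \<tau>) 0"
  \<comment> \<open>Existence of a decomposition gives the choice in \<open>soft_threshold\<close>
    its defining property; the argument works with whichever decomposition was chosen.\<close>
  have "\<exists>Z U V. is_svd X U V \<and> Z = U ** rect_diag ?d ** transpose V"
    using svd_exists by blast
  then have "\<exists>U V. is_svd X U V \<and> Z = U ** rect_diag ?d ** transpose V"
    unfolding Z_def soft_threshold_def by (rule someI_ex)
  then obtain U V where UV: "is_svd X U V" and Z: "Z = U ** rect_diag ?d ** transpose V" by blast
  obtain u v where uv: "orthonormal_on {..<?m} u" "orthonormal_on {..<?m} v"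
    and eq: "\<And>d. U ** rect_diag d ** transpose V = svd_sum ?m d u v"
    using is_svd_svd_sum[OF UV] by metis
  have Z: "Z = svd_sum ?m ?d u v" by (simp add: Z eq)
  have "X = svd_sum ?m ?\<sigma> u v" using UV eq by (simp add: is_svd_def)
  then have XZ: "X - Z = svd_sum ?m (\<lambda>i. ?\<sigma> i - ?d i) u v"
    unfolding Z svd_sum_diff[symmetric] by (rule arg_cong)
  have "(X - Z) \<bullet> Y \<le> \<tau> * nuclear_norm Y"
    unfolding XZ using assms(1) sing_val_nonneg[of _ X]
    by (intro inner_svd_sum_le_nuclear_norm[OF uv]) (auto simp: max_def)
  moreover have "(X - Z) \<bullet> Z = (\<Sum>i<?m. (?\<sigma> i - ?d i) * ?d i)"
    unfolding XZ unfolding Z by (rule inner_svd_sum_same[OF uv])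
  moreover have "\<dots> = (\<Sum>i<?m. \<tau> * ?d i)"
    by (intro sum.cong refl) (simp add: max_def)
  moreover have "\<dots> = \<tau> * nuclear_norm Z"
    unfolding Z using nuclear_norm_svd_sum[OF uv, of ?d] by (simp add: sum_distrib_left)
  ultimately show ?thesis by (simp add: inner_diff_right)
qed

section \<open>Spectral functions\<close>

text \<open>Rearranged, the tangent inequality is a Young bound on \<open>h' t * s\<close> by
  \<open>h' t * t - h t\<close> plus \<open>h s\<close>, which \<open>inner_svd_sum_le\<close>
  accepts. Its first part is nonnegative by the tangent inequality at \<open>s = 0\<close> and
  \<open>h 0 = 0\<close>.\<close>

lemma spectral_subgradient:
  fixes X Y :: "real^'n2^'n1"
  defines "m \<equiv> min CARD('n1) CARD('n2)"
  assumes uv: "orthonormal_on {..<m} u" "orthonormal_on {..<m} v"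
    and X: "X = svd_sum m (sing_val X) u v"
    and tangent: "\<And>s t. 0 \<le> s \<Longrightarrow> 0 \<le> t \<Longrightarrow> h t + h' t * (s - t) \<le> h s"
    and h: "h 0 = 0" "\<And>t. 0 \<le> t \<Longrightarrow> 0 \<le> h t" "\<And>t. 0 \<le> t \<Longrightarrow> 0 \<le> h' t"
  shows "(\<Sum>i<m. h (sing_val X i)) + svd_sum m (\<lambda>i. h' (sing_val X i)) u v \<bullet> (Y - X)
           \<le> (\<Sum>i<m. h (sing_val Y i))"
proof -
  obtain u' v' where uv': "orthonormal_on {..<m} u'" "orthonormal_on {..<m} v'"
    and Y: "Y = svd_sum m (sing_val Y) u' v'"
    unfolding m_def by (rule svd_sum_exists)
  let ?g = "\<lambda>i. h' (sing_val X i)"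
  have X0: "0 \<le> sing_val X j" and Y0: "0 \<le> sing_val Y j" if "j < m" for j
    using that by (simp_all add: m_def sing_val_nonneg)
  have "svd_sum m ?g u v \<bullet> svd_sum m (sing_val Y) u' v'
      \<le> (\<Sum>i<m. ?g i * sing_val X i - h (sing_val X i)) + (\<Sum>j<m. h (sing_val Y j))"
  proof (rule inner_svd_sum_le[OF uv uv'])
    fix i j assume ij: "i < m" "j < m"
    show "0 \<le> ?g i * sing_val Y j" using X0[OF ij(1)] Y0[OF ij(2)] h by simp
    show "?g i * sing_val Y j \<le> ?g i * sing_val X i - h (sing_val X i) + h (sing_val Y j)"
      using tangent[OF Y0[OF ij(2)] X0[OF ij(1)]] by (simp add: algebra_simps)
  next
    fix i assume i: "i < m"
    show "0 \<le> ?g i * sing_val X i - h (sing_val X i)"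
      using tangent[of 0 "sing_val X i"] X0[OF i] h(1) by simp
    show "0 \<le> h (sing_val Y i)" using Y0[OF i] h(2) by simp
  qed
  moreover have "svd_sum m ?g u v \<bullet> X = (\<Sum>i<m. ?g i * sing_val X i)"
    by (subst X) (rule inner_svd_sum_same[OF uv])
  ultimately show ?thesis
    by (simp add: inner_diff_right sum_subtractf flip: Y)
qed

section \<open>Two-sided quadratic estimates and Gateaux gradients\<close>

definition quadratic_approx :: "real \<Rightarrow> ('a::real_inner \<Rightarrow> real) \<Rightarrow> 'a \<Rightarrow> 'a \<Rightarrow> bool" where
  "quadratic_approx C f G x \<longleftrightarrow> (\<forall>y. \<bar>f y - f x - G \<bullet> (y - x)\<bar> \<le> C * (norm (y - x))\<^sup>2)"

lemma quadratic_approx_isCont: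
  assumes "quadratic_approx C f G x"
  shows "isCont f x"
proof -
  have "((\<lambda>y. C * (norm (y - x))\<^sup>2) \<longlongrightarrow> C * (norm (x - x))\<^sup>2) (at x)"
    by (intro tendsto_intros)
  then have lim: "((\<lambda>y. C * (norm (y - x))\<^sup>2) \<longlongrightarrow> 0) (at x)" by simp
  have "\<forall>\<^sub>F y in at x. norm (f y - f x - G \<bullet> (y - x)) \<le> C * (norm (y - x))\<^sup>2"
    using assms by (simp add: quadratic_approx_def)
  then have "((\<lambda>y. f y - f x - G \<bullet> (y - x)) \<longlongrightarrow> 0) (at x)"
    using lim by (rule Lim_null_comparison)
  moreover have "((\<lambda>y. G \<bullet> (y - x)) \<longlongrightarrow> G \<bullet> (x - x)) (at x)"
    by (intro tendsto_intros)
  ultimately have "((\<lambda>y. (f y - f x - G \<bullet> (y - x)) + G \<bullet> (y - x)) \<longlongrightarrow> 0 + G \<bullet> (x - x)) (at x)"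
    by (rule tendsto_add)
  then show ?thesis by (simp add: isCont_def LIM_zero_iff)
qed

lemma quadratic_approx_gateaux:
  assumes "quadratic_approx C f G x"
  shows "has_gateaux_gradient f G x"
  unfolding has_gateaux_gradient_def
proof
  fix h
  have "\<bar>(f (x + t *\<^sub>R h) - f x) / t - G \<bullet> h\<bar> \<le> C * (norm h)\<^sup>2 * \<bar>t\<bar>" if "t \<noteq> 0" for t
  proof -
    have "\<bar>f (x + t *\<^sub>R h) - f x - t * (G \<bullet> h)\<bar> \<le> C * (\<bar>t\<bar> * norm h)\<^sup>2"
      using assms[unfolded quadratic_approx_def, rule_format, of "x + t *\<^sub>R h"] by simp
    moreover have "(f (x + t *\<^sub>R h) - f x) / t - G \<bullet> h = (f (x + t *\<^sub>R h) - f x - t * (G \<bullet> h)) / t"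
      using that by (simp add: field_simps)
    ultimately show ?thesis
      using that by (simp add: divide_simps power2_eq_square mult_ac)
  qed
  then have "eventually (\<lambda>t. norm ((f (x + t *\<^sub>R h) - f x) / t - G \<bullet> h) \<le> C * (norm h)\<^sup>2 * \<bar>t\<bar>) (at 0)"
    by (auto simp: eventually_at_filter)
  moreover have "((\<lambda>t. C * (norm h)\<^sup>2 * \<bar>t\<bar>) \<longlongrightarrow> C * (norm h)\<^sup>2 * \<bar>0\<bar>) (at 0)"
    by (intro tendsto_intros)
  then have "((\<lambda>t. C * (norm h)\<^sup>2 * \<bar>t\<bar>) \<longlongrightarrow> 0) (at 0)" by simp
  ultimately have "((\<lambda>t. (f (x + t *\<^sub>R h) - f x) / t - G \<bullet> h) \<longlongrightarrow> 0) (at 0)"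
    by (rule Lim_null_comparison)
  then show "((\<lambda>t. f (x + t *\<^sub>R h)) has_real_derivative (G \<bullet> h)) (at 0)"
    by (simp add: DERIV_def LIM_zero_iff)
qed

lemma gateaux_gradient_eqI:
  assumes "has_gateaux_gradient f G x"
  shows "gateaux_gradient f x = G"
  unfolding gateaux_gradient_def
proof (rule the_equality)
  fix G' assume "has_gateaux_gradient f G' x"
  then have "G' \<bullet> h = G \<bullet> h" for h
    using assms DERIV_unique unfolding has_gateaux_gradient_def by blast
  then have "(G' - G) \<bullet> (G' - G) = 0" by (simp add: inner_diff_left)
  then show "G' = G" by simp
qed (rule assms)

text \<open>For each fixed \<open>y\<close> the estimate is a closed condition on base point and
  gradient, because \<open>C\<close> is the same for all \<open>n\<close>.\<close>

lemma quadratic_approx_limit: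
  assumes approx: "\<And>n. quadratic_approx C f (G n) (x n)"
    and x: "x \<longlonglongrightarrow> x'" and G: "G \<longlonglongrightarrow> G'" and "isCont f x'"
  shows "quadratic_approx C f G' x'"
  unfolding quadratic_approx_def
proof
  fix y
  have fx: "(\<lambda>n. f (x n)) \<longlonglongrightarrow> f x'"
    using isCont_tendsto_compose[OF assms(4) x] .
  have "(\<lambda>n. \<bar>f y - f (x n) - G n \<bullet> (y - x n)\<bar>) \<longlonglongrightarrow> \<bar>f y - f x' - G' \<bullet> (y - x')\<bar>"
    "(\<lambda>n. C * (norm (y - x n))\<^sup>2) \<longlonglongrightarrow> C * (norm (y - x'))\<^sup>2"
    by (intro tendsto_intros fx x G)+
  then show "\<bar>f y - f x' - G' \<bullet> (y - x')\<bar> \<le> C * (norm (y - x'))\<^sup>2"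
    by (rule LIMSEQ_le) (use approx in \<open>auto simp: quadratic_approx_def\<close>)
qed

section \<open>Concavity and gradient of \<open>Psi_hat\<close>\<close>

lemma Psi_hat_eq:
  fixes X :: "real^'n2^'n1"
  assumes "\<alpha> > 0"
  shows "Psi_hat \<alpha> X = - (\<Sum>i<min CARD('n1) CARD('n2). (\<alpha> * sing_val X i)\<^sup>2 / (1 + \<alpha> * sing_val X i))"
proof -
  \<comment> \<open>Subtracting the linear term cancels the slope of \<open>phi\<close> at 0. The
    remaining function vanishes there to second order, which explains the smoothness of
    \<open>Psi_hat\<close> at matrices with zero singular values.\<close>
  have "phi \<alpha> (sing_val X i) - \<alpha> * sing_val X i
      = - ((\<alpha> * sing_val X i)\<^sup>2 / (1 + \<alpha> * sing_val X i))" if "i < min CARD('n1) CARD('n2)" for i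
  proof -
    have "0 \<le> \<alpha> * sing_val X i" using assms sing_val_nonneg[OF that] by simp
    then have "1 + \<alpha> * sing_val X i \<noteq> 0" by linarith
    then show ?thesis
      using sing_val_nonneg[OF that] by (simp add: phi_def field_simps power2_eq_square)
  qed
  then show ?thesis
    by (simp add: Psi_hat_def Phi_hat_def nuclear_norm_def rank_bound_def sum_distrib_left
        flip: sum_subtractf sum_negf)
qed

lemma Psi_hat_ge:
  assumes "\<alpha> > 0"
  shows "- \<alpha> * nuclear_norm X \<le> Psi_hat \<alpha> X"
proof -
  have "0 \<le> Phi_hat \<alpha> X"
    unfolding Phi_hat_def phi_def using assms by (intro sum_nonneg) auto
  then show ?thesis by (simp add: Psi_hat_def)
qed

text \<open>With \<open>p = 1 + \<alpha> * s\<close> and \<open>q = 1 + \<alpha> * t\<close>, the gap between \<open>h\<close> and its tangent is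
  \<open>(p - q)\<^sup>2 / (p * q\<^sup>2)\<close>, which lies between \<open>0\<close> and \<open>(p - q)\<^sup>2\<close>. So both \<open>h\<close> and
  \<open>\<lambda>t. (\<alpha> * t)\<^sup>2 - h t\<close> lie above their tangents.\<close>

lemma tangent_gap:
  fixes \<alpha> s t :: real
  assumes "\<alpha> > 0" "0 \<le> s" "0 \<le> t"
  defines "h \<equiv> \<lambda>t. (\<alpha> * t)\<^sup>2 / (1 + \<alpha> * t)" and "h' \<equiv> \<lambda>t. \<alpha> * (1 - 1 / (1 + \<alpha> * t)\<^sup>2)"
  shows "h t + h' t * (s - t) \<le> h s" and "h s \<le> h t + h' t * (s - t) + (\<alpha> * (s - t))\<^sup>2"
proof -
  define p q where "p = 1 + \<alpha> * s" and "q = 1 + \<alpha> * t"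
  have pq: "p \<ge> 1" "q \<ge> 1" using assms(1-3) by (simp_all add: p_def q_def)
  have eq: "\<alpha> * s = p - 1" "\<alpha> * t = q - 1" by (simp_all add: p_def q_def)
  have "h' t * (s - t) = (1 - 1 / q\<^sup>2) * (\<alpha> * s - \<alpha> * t)"
    by (simp add: h'_def q_def algebra_simps)
  also have "\<dots> = (1 - 1 / q\<^sup>2) * (p - q)" by (simp add: eq)
  finally have lin: "h' t * (s - t) = (1 - 1 / q\<^sup>2) * (p - q)" .
  have "h s = (p - 1)\<^sup>2 / p" "h t = (q - 1)\<^sup>2 / q" by (simp_all add: h_def p_def q_def)
  then have hs: "h s = p - 2 + 1 / p" "h t = q - 2 + 1 / q"
    using pq by (simp_all add: field_simps power2_eq_square)
  have gap: "h s - (h t + h' t * (s - t)) = (p - q)\<^sup>2 / (p * q\<^sup>2)"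
    unfolding lin hs using pq by (simp add: field_simps power2_eq_square)
  show "h t + h' t * (s - t) \<le> h s"
    using gap pq by (smt (verit) divide_nonneg_nonneg mult_nonneg_nonneg zero_le_power2)
  have "1 * 1 \<le> p * q\<^sup>2" using pq by (intro mult_mono) auto
  then have "(p - q)\<^sup>2 / (p * q\<^sup>2) \<le> (p - q)\<^sup>2 / 1" by (intro divide_left_mono) auto
  moreover have "p - q = \<alpha> * (s - t)" by (simp add: p_def q_def algebra_simps)
  ultimately show "h s \<le> h t + h' t * (s - t) + (\<alpha> * (s - t))\<^sup>2" using gap by simp
qed

text \<open>\<open>spectral_subgradient\<close> is applied to \<open>?h\<close> for the upper bound
  and to \<open>?k\<close> for the lower one, with the same singular vectors of \<open>X\<close>.
  The squares in \<open>?k\<close> sum to \<open>\<alpha>\<^sup>2\<close> times the squared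
  Frobenius norm, whose own gradient accounts for the difference, so both bounds have the same
  linear part \<open>- ?H\<close>.\<close>

lemma Psi_hat_gradient_exists:
  fixes X :: "real^'n2^'n1"
  assumes \<alpha>: "\<alpha> > 0"
  obtains G where "\<And>Y. Psi_hat \<alpha> Y \<le> Psi_hat \<alpha> X + G \<bullet> (Y - X)"
    "quadratic_approx (\<alpha>\<^sup>2) (Psi_hat \<alpha>) G X"
proof -
  let ?m = "min CARD('n1) CARD('n2)"
  let ?h = "\<lambda>t. (\<alpha> * t)\<^sup>2 / (1 + \<alpha> * t)" and ?h' = "\<lambda>t. \<alpha> * (1 - 1 / (1 + \<alpha> * t)\<^sup>2)"
  let ?k = "\<lambda>t. (\<alpha> * t)\<^sup>2 - ?h t" and ?k' = "\<lambda>t. 2 * \<alpha>\<^sup>2 * t - ?h' t"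
  let ?\<sigma> = "sing_val X"
  note gap = tangent_gap[OF \<alpha>]
  obtain u v where uv: "orthonormal_on {..<?m} u" "orthonormal_on {..<?m} v"
    and X: "X = svd_sum ?m ?\<sigma> u v"
    by (rule svd_sum_exists)
  let ?H = "svd_sum ?m (\<lambda>i. ?h' (?\<sigma> i)) u v"
  have h'0: "0 \<le> ?h' t" if "0 \<le> t" for t
  proof -
    have "1 \<le> (1 + \<alpha> * t)\<^sup>2" using \<alpha> that by (intro one_le_power) simp
    then show ?thesis using \<alpha> by (intro mult_nonneg_nonneg) (auto simp: divide_le_eq_1)
  qed
  \<comment> \<open>This is nonnegativity of \<open>?k'\<close>, required by
    \<open>spectral_subgradient\<close>.\<close>
  have h'le: "?h' t \<le> 2 * \<alpha>\<^sup>2 * t" if "0 \<le> t" for t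
  proof -
    define q where "q = 1 + \<alpha> * t"
    have q: "q \<ge> 1" using \<alpha> that by (simp add: q_def)
    have "1 - 1 / q\<^sup>2 = (q - 1) * ((q + 1) / q\<^sup>2)"
      using q by (simp add: field_simps power2_eq_square)
    also have "\<dots> \<le> (q - 1) * 2"
    proof (rule mult_left_mono)
      have "q \<le> q * q" using q by simp
      then have "q + 1 \<le> 2 * (q * q)" using q by linarith
      then show "(q + 1) / q\<^sup>2 \<le> 2" using q by (simp add: divide_le_eq power2_eq_square)
    qed (use q in simp)
    finally have "\<alpha> * (1 - 1 / q\<^sup>2) \<le> \<alpha> * ((q - 1) * 2)" using \<alpha> by (intro mult_left_mono) auto
    then show ?thesis by (simp add: q_def power2_eq_square mult_ac)
  qed
  have k0: "0 \<le> ?k t" if "0 \<le> t" for t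
    using gap(2)[OF that order.refl] by simp
  have concave: "Psi_hat \<alpha> Y \<le> Psi_hat \<alpha> X + (- ?H) \<bullet> (Y - X)" for Y
  proof -
    have "(\<Sum>i<?m. ?h (?\<sigma> i)) + ?H \<bullet> (Y - X) \<le> (\<Sum>i<?m. ?h (sing_val Y i))"
    proof (rule spectral_subgradient[OF uv X])
      show "?h t + ?h' t * (s - t) \<le> ?h s" if "0 \<le> s" "0 \<le> t" for s t
        by (rule gap(1)[OF that])
      show "0 \<le> ?h t" if "0 \<le> t" for t using \<alpha> that by simp
    qed (simp, rule h'0)
    then show ?thesis by (simp add: Psi_hat_eq[OF \<alpha>])
  qed
  have below: "Psi_hat \<alpha> X + (- ?H) \<bullet> (Y - X) - \<alpha>\<^sup>2 * (norm (Y - X))\<^sup>2 \<le> Psi_hat \<alpha> Y" for Y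
  proof -
    let ?K = "svd_sum ?m (\<lambda>i. ?k' (?\<sigma> i)) u v"
    define S where "S Z = (\<Sum>i<?m. ?h (sing_val Z i))" for Z :: "real^'n2^'n1"
    have "(\<Sum>i<?m. ?k (?\<sigma> i)) + ?K \<bullet> (Y - X) \<le> (\<Sum>i<?m. ?k (sing_val Y i))"
    proof (rule spectral_subgradient[OF uv X])
      show "?k t + ?k' t * (s - t) \<le> ?k s" if "0 \<le> s" "0 \<le> t" for s t
        using gap(2)[OF that] by (simp add: power2_eq_square algebra_simps)
      show "0 \<le> ?k' t" if "0 \<le> t" for t using h'le[OF that] by linarith
    qed (simp, rule k0)
    moreover have "(\<Sum>i<?m. (\<alpha> * sing_val Z i)\<^sup>2) = \<alpha>\<^sup>2 * (Z \<bullet> Z)" for Z :: "real^'n2^'n1"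
    proof -
      obtain u v where uv: "orthonormal_on {..<?m} u" "orthonormal_on {..<?m} v"
        and Z: "Z = svd_sum ?m (sing_val Z) u v"
        by (rule svd_sum_exists)
      have "Z \<bullet> Z = svd_sum ?m (sing_val Z) u v \<bullet> svd_sum ?m (sing_val Z) u v" by (simp flip: Z)
      then show ?thesis
        by (simp add: inner_svd_sum_same[OF uv] sum_distrib_left power_mult_distrib)
           (simp add: power2_eq_square)
    qed
    ultimately have "\<alpha>\<^sup>2 * (X \<bullet> X) - S X + ?K \<bullet> (Y - X) \<le> \<alpha>\<^sup>2 * (Y \<bullet> Y) - S Y"
      by (simp only: sum_subtractf S_def)
    moreover have "?K = (2 * \<alpha>\<^sup>2) *\<^sub>R X - ?H"
      by (subst X) (simp add: svd_sum_scale svd_sum_diff)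
    moreover have "((2 * \<alpha>\<^sup>2) *\<^sub>R X - ?H) \<bullet> (Y - X)
        = \<alpha>\<^sup>2 * (2 * (X \<bullet> Y) - 2 * (X \<bullet> X)) - ?H \<bullet> (Y - X)"
      by (simp add: inner_diff_left inner_diff_right algebra_simps)
    moreover have "(norm (Y - X))\<^sup>2 = Y \<bullet> Y - 2 * (X \<bullet> Y) + X \<bullet> X"
      by (simp add: power2_norm_eq_inner inner_diff_left inner_diff_right inner_commute)
    moreover have "Psi_hat \<alpha> Z = - S Z" for Z :: "real^'n2^'n1"
      by (simp add: Psi_hat_eq[OF \<alpha>] S_def)
    ultimately show ?thesis
      by (simp only: inner_minus_left) (simp only: algebra_simps)
  qed
  show ?thesis
  proof
    show "Psi_hat \<alpha> Y \<le> Psi_hat \<alpha> X + (- ?H) \<bullet> (Y - X)" for Y by (rule concave)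
    show "quadratic_approx (\<alpha>\<^sup>2) (Psi_hat \<alpha>) (- ?H) X"
      unfolding quadratic_approx_def
    proof
      fix Y
      have "0 \<le> \<alpha>\<^sup>2 * (norm (Y - X))\<^sup>2" by simp
      then show "\<bar>Psi_hat \<alpha> Y - Psi_hat \<alpha> X - (- ?H) \<bullet> (Y - X)\<bar> \<le> \<alpha>\<^sup>2 * (norm (Y - X))\<^sup>2"
        using concave[of Y] below[of Y] by linarith
    qed
  qed
qed

text \<open>Uniqueness of Gateaux gradients turns the matrix found above into the gradient that the
  iteration uses.\<close>

lemma
  assumes "\<alpha> > 0"
  shows Psi_hat_concave: "Psi_hat \<alpha> Y \<le> Psi_hat \<alpha> X + gateaux_gradient (Psi_hat \<alpha>) X \<bullet> (Y - X)"
    and Psi_hat_quadratic_approx: "quadratic_approx (\<alpha>\<^sup>2) (Psi_hat \<alpha>) (gateaux_gradient (Psi_hat \<alpha>) X) X"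
proof -
  obtain G where G: "\<And>Y. Psi_hat \<alpha> Y \<le> Psi_hat \<alpha> X + G \<bullet> (Y - X)"
    "quadratic_approx (\<alpha>\<^sup>2) (Psi_hat \<alpha>) G X"
    using Psi_hat_gradient_exists[OF assms, where X = X] by blast
  have "gateaux_gradient (Psi_hat \<alpha>) X = G"
    using G(2) by (intro gateaux_gradient_eqI quadratic_approx_gateaux)
  with G show "Psi_hat \<alpha> Y \<le> Psi_hat \<alpha> X + gateaux_gradient (Psi_hat \<alpha>) X \<bullet> (Y - X)"
    "quadratic_approx (\<alpha>\<^sup>2) (Psi_hat \<alpha>) (gateaux_gradient (Psi_hat \<alpha>) X) X" by simp_all
qed

section \<open>Descent and convergence\<close>

text \<open>Here \<open>P\<close> stands for the gradient of \<^term>\<open>Psi_hat \<alpha>\<close> at \<open>X\<close>, kept as a parameter so that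
  it can be replaced by the limit of such gradients.\<close>

definition objective_gradient ::
    "real \<Rightarrow> real \<Rightarrow> real \<Rightarrow> (real^'n2^'n1 \<Rightarrow> real^'n3) \<Rightarrow> real^'n3 \<Rightarrow> real^'n2^'n1 \<Rightarrow> real^'n2^'n1
      \<Rightarrow> real^'n2^'n1 \<Rightarrow> real^'n2^'n1" where
  "objective_gradient \<beta> lam \<rho> A b P X W =
     adjoint A (A X - b) + (lam * \<beta>) *\<^sub>R P + \<rho> *\<^sub>R (X - W)"

lemma power2_norm_add:
  fixes x y :: "'a::real_inner"
  shows "(norm (x + y))\<^sup>2 = (norm x)\<^sup>2 + 2 * (x \<bullet> y) + (norm y)\<^sup>2"
  by (simp add: power2_norm_eq_inner inner_add_left inner_add_right inner_commute)

text \<open>Apart from \<open>Psi_hat\<close> the objective is quadratic in its first argument, so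
  the expansion is exact, and \<open>P\<close> may be any matrix because its two occurrences cancel.
  It serves both the descent estimate and differentiability at the limit.\<close>

lemma objective_expansion:
  fixes A :: "real^'n2^'n1 \<Rightarrow> real^'n3"
  assumes "linear A"
  shows "objective \<alpha> \<beta> lam \<rho> A b Y W = objective \<alpha> \<beta> lam \<rho> A b X W
    + objective_gradient \<beta> lam \<rho> A b P X W \<bullet> (Y - X)
    + (norm (A (Y - X)))\<^sup>2 / 2 + \<rho> / 2 * (norm (Y - X))\<^sup>2
    + lam * \<beta> * (Psi_hat \<alpha> Y - Psi_hat \<alpha> X - P \<bullet> (Y - X))"
proof -
  define D where "D = Y - X"
  have Y: "Y = X + D" by (simp add: D_def)
  have "A Y - b = (A X - b) + A D" unfolding Y using linear_add[OF assms] by simp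
  then have AY: "(norm (A Y - b))\<^sup>2 = (norm (A X - b))\<^sup>2 + 2 * ((A X - b) \<bullet> A D) + (norm (A D))\<^sup>2"
    by (simp only: power2_norm_add)
  have adj: "adjoint A (A X - b) \<bullet> D = (A X - b) \<bullet> A D"
    by (rule adjoint_clauses(2)[OF assms])
  have YW: "(norm (Y - W))\<^sup>2 = (norm (X - W))\<^sup>2 + 2 * ((X - W) \<bullet> D) + (norm D)\<^sup>2"
    using power2_norm_add[of "X - W" D] by (simp add: Y algebra_simps)
  show ?thesis
    unfolding objective_def objective_gradient_def D_def[symmetric] AY YW
      inner_add_left inner_scaleR_left adj
    by (simp add: distrib_left right_diff_distrib add_divide_distrib)
qed

lemma objective_quadratic_approx:
  fixes A :: "real^'n2^'n1 \<Rightarrow> real^'n3"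
  assumes A: "linear A" and pos: "\<beta> > 0" "lam > 0" "\<rho> > 0"
    and P: "quadratic_approx C (Psi_hat \<alpha>) P X"
  shows "\<exists>C. quadratic_approx C (\<lambda>X. objective \<alpha> \<beta> lam \<rho> A b X W)
           (objective_gradient \<beta> lam \<rho> A b P X W) X"
proof -
  obtain K where K: "\<And>x. norm (A x) \<le> K * norm x"
    using linear_bounded[OF A] by blast
  have "\<bar>objective \<alpha> \<beta> lam \<rho> A b Y W - objective \<alpha> \<beta> lam \<rho> A b X W
      - objective_gradient \<beta> lam \<rho> A b P X W \<bullet> (Y - X)\<bar>
      \<le> (K\<^sup>2 / 2 + \<rho> / 2 + lam * \<beta> * C) * (norm (Y - X))\<^sup>2" for Y
  proof -
    let ?R = "Psi_hat \<alpha> Y - Psi_hat \<alpha> X - P \<bullet> (Y - X)"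
    have "(norm (A (Y - X)))\<^sup>2 \<le> K\<^sup>2 * (norm (Y - X))\<^sup>2"
      using power_mono[OF K, of "Y - X" 2] by (simp add: power_mult_distrib)
    moreover have "lam * \<beta> * \<bar>?R\<bar> \<le> lam * \<beta> * (C * (norm (Y - X))\<^sup>2)"
      using P pos by (intro mult_left_mono) (simp_all add: quadratic_approx_def)
    then have "\<bar>lam * \<beta> * ?R\<bar> \<le> lam * \<beta> * (C * (norm (Y - X))\<^sup>2)"
      using pos by (simp add: abs_mult)
    moreover have "0 \<le> \<rho> / 2 * (norm (Y - X))\<^sup>2" using pos by simp
    moreover have "0 \<le> (norm (A (Y - X)))\<^sup>2" by simp
    moreover have "(K\<^sup>2 / 2 + \<rho> / 2 + lam * \<beta> * C) * (norm (Y - X))\<^sup>2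
        = K\<^sup>2 * (norm (Y - X))\<^sup>2 / 2 + \<rho> / 2 * (norm (Y - X))\<^sup>2 + lam * \<beta> * (C * (norm (Y - X))\<^sup>2)"
      by (simp add: algebra_simps)
    ultimately show ?thesis
      unfolding objective_expansion[OF A, of \<alpha> \<beta> lam \<rho> b Y W X P] by linarith
  qed
  then show ?thesis unfolding quadratic_approx_def by blast
qed

text \<open>Multiplying the subgradient inequality by \<open>\<rho>\<close> turns
  \<open>\<tau>\<close> into the weight of the nuclear norm; expanding the square around
  \<open>?Z\<close> leaves a nonnegative remainder.\<close>

lemma objective_soft_threshold_le:
  fixes A :: "real^'n2^'n1 \<Rightarrow> real^'n3"
  assumes "0 \<le> lam * (1 + \<alpha> * \<beta>)" "\<rho> > 0" and \<tau>: "\<tau> = lam * (1 + \<alpha> * \<beta>) / \<rho>"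
  shows "objective \<alpha> \<beta> lam \<rho> A b X (soft_threshold \<tau> X) \<le> objective \<alpha> \<beta> lam \<rho> A b X W"
proof -
  let ?Z = "soft_threshold \<tau> X"
  have "0 \<le> \<tau>" using assms by simp
  then have "(X - ?Z) \<bullet> (W - ?Z) \<le> \<tau> * nuclear_norm W - \<tau> * nuclear_norm ?Z"
    by (rule soft_threshold_subgradient)
  then have "\<rho> * ((X - ?Z) \<bullet> (W - ?Z)) \<le> \<rho> * (\<tau> * nuclear_norm W - \<tau> * nuclear_norm ?Z)"
    using assms by (intro mult_left_mono) auto
  moreover have "\<rho> * (\<tau> * N) = lam * (1 + \<alpha> * \<beta>) * N" for N
    using assms(2) by (simp add: \<tau>)
  ultimately have "\<rho> * ((X - ?Z) \<bullet> (W - ?Z))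
      \<le> lam * (1 + \<alpha> * \<beta>) * nuclear_norm W - lam * (1 + \<alpha> * \<beta>) * nuclear_norm ?Z"
    by (simp only: right_diff_distrib)
  moreover have sq: "(norm (X - W))\<^sup>2
      = (norm (X - ?Z))\<^sup>2 - 2 * ((X - ?Z) \<bullet> (W - ?Z)) + (norm (W - ?Z))\<^sup>2"
    by (simp add: power2_norm_eq_inner inner_diff_left inner_diff_right inner_commute)
  have "\<rho> / 2 * (norm (X - W))\<^sup>2 = \<rho> / 2 * (norm (X - ?Z))\<^sup>2
      - \<rho> * ((X - ?Z) \<bullet> (W - ?Z)) + \<rho> / 2 * (norm (W - ?Z))\<^sup>2"
    unfolding sq by (simp add: distrib_left right_diff_distrib)
  moreover have "0 \<le> \<rho> / 2 * (norm (W - ?Z))\<^sup>2" using assms by simp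
  ultimately show ?thesis unfolding objective_def by linarith
qed

text \<open>Part of the nuclear norm penalty on \<open>W\<close> offsets the lower bound of
  \<open>Psi_hat\<close> at \<open>X\<close>, at a Lipschitz cost of
  \<open>c * norm (X - W)\<close>, which the quadratic coupling term absorbs. The rest of the
  penalty controls \<open>W\<close>.\<close>

lemma objective_coercive:
  fixes A :: "real^'n2^'n1 \<Rightarrow> real^'n3"
  assumes pos: "\<alpha> > 0" "\<beta> > 0" "lam > 0" "\<rho> > 0"
  obtains K where "\<And>X W. lam * norm W + norm (X - W) \<le> objective \<alpha> \<beta> lam \<rho> A b X W + K"
proof
  define c where "c = lam * \<beta> * \<alpha> * sqrt (min CARD('n1) CARD('n2))"
  fix X W :: "real^'n2^'n1"
  define t where "t = norm (X - W)"
  have "lam * \<beta> * \<alpha> * (nuclear_norm X - nuclear_norm W)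
      \<le> lam * \<beta> * \<alpha> * (sqrt (min CARD('n1) CARD('n2)) * t)"
    unfolding t_def using pos nuclear_norm_lipschitz[of X W] by (intro mult_left_mono) auto
  then have "lam * \<beta> * \<alpha> * nuclear_norm X - lam * \<beta> * \<alpha> * nuclear_norm W \<le> c * t"
    by (simp only: c_def right_diff_distrib mult.assoc)
  moreover have "lam * \<beta> * (- \<alpha> * nuclear_norm X) \<le> lam * \<beta> * Psi_hat \<alpha> X"
    using pos Psi_hat_ge[OF pos(1), of X] by (intro mult_left_mono) auto
  then have "- (lam * \<beta> * \<alpha> * nuclear_norm X) \<le> lam * \<beta> * Psi_hat \<alpha> X"
    by (simp only: mult_minus_left mult_minus_right mult.assoc)
  moreover have "lam * norm W \<le> lam * nuclear_norm W"
    using pos norm_le_nuclear_norm[of W] by (intro mult_left_mono) auto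
  moreover have "lam * (1 + \<alpha> * \<beta>) * nuclear_norm W
      = lam * nuclear_norm W + lam * \<beta> * \<alpha> * nuclear_norm W"
    by (simp add: algebra_simps)
  \<comment> \<open>Completing the square: \<open>c\<close> pays for the Lipschitz cost, and the
    extra 1 leaves \<open>norm (X - W)\<close> on the left of the claim.\<close>
  moreover have "0 \<le> (\<rho> * t - (c + 1))\<^sup>2 / (2 * \<rho>)" using pos by simp
  moreover have "(\<rho> * t - (c + 1))\<^sup>2 / (2 * \<rho>) = \<rho> / 2 * t\<^sup>2 - (c * t + t) + (c + 1)\<^sup>2 / (2 * \<rho>)"
    using pos by (simp add: field_simps power2_eq_square)
  moreover have "0 \<le> (norm (A X - b))\<^sup>2" by simp
  ultimately show "lam * norm W + norm (X - W) \<le> objective \<alpha> \<beta> lam \<rho> A b X W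
      + (lam * \<beta> * \<alpha> * sqrt (min CARD('n1) CARD('n2)) + 1)\<^sup>2 / (2 * \<rho>)"
    unfolding objective_def t_def[symmetric] c_def[symmetric] by linarith
qed

theorem theorem2p1:
  fixes \<alpha> \<beta> lam \<rho> \<tau> :: real
    and A :: "real^'n2^'n1 \<Rightarrow> real^'n3"
    and b :: "real^'n3"
    and X W \<Delta>X :: "nat \<Rightarrow> real^'n2^'n1"
  assumes "\<alpha> > 0" and "\<beta> > 0" and "lam > 0" and "\<rho> > 0"
    and "linear A"
    and "\<tau> = lam * (1 + \<alpha> * \<beta>) / \<rho>"
    and "\<And>s. s \<ge> 1 \<Longrightarrow> W s = soft_threshold \<tau> (X (s - 1))"
    and "\<And>s. s \<ge> 1 \<Longrightarrow> X s = X (s - 1) + \<Delta>X s"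
    and "\<And>s. s \<ge> 1 \<Longrightarrow>
           adjoint A (A (\<Delta>X s)) + \<rho> *\<^sub>R \<Delta>X s =
             adjoint A (b - A (X (s - 1)))
             - (lam * \<beta>) *\<^sub>R gateaux_gradient (Psi_hat \<alpha>) (X (s - 1))
             + \<rho> *\<^sub>R (W s - X (s - 1))"
  shows "\<exists>(r :: nat \<Rightarrow> nat) Wstar Xstar.
           strict_mono r \<and> (\<forall>k. r k \<ge> 1) \<and>
           (\<lambda>k. (W (r k), X (r k))) \<longlonglongrightarrow> (Wstar, Xstar) \<and>
           is_critical_point (objective \<alpha> \<beta> lam \<rho> A b) (Wstar, Xstar)"
proof -
  note pos = assms(1-4) and A = \<open>linear A\<close>
  let ?E = "objective \<alpha> \<beta> lam \<rho> A b"
  let ?P = "\<lambda>n. gateaux_gradient (Psi_hat \<alpha>) (X n)"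
  let ?G = "\<lambda>n. objective_gradient \<beta> lam \<rho> A b (?P n) (X n) (W (Suc n))"
  have Wn: "W (Suc n) = soft_threshold \<tau> (X n)" for n using assms(7)[of "Suc n"] by simp
  have Xn: "X (Suc n) = X n + \<Delta>X (Suc n)" for n using assms(8)[of "Suc n"] by simp
  have adj_lin: "linear (adjoint A)" by (rule adjoint_linear[OF A])
  \<comment> \<open>The linear system expresses the gradient through the increment alone, so it
    vanishes in the limit once the increments do.\<close>
  have Gn: "?G n = - (adjoint A (A (\<Delta>X (Suc n))) + \<rho> *\<^sub>R \<Delta>X (Suc n))" for n
  proof -
    have "adjoint A (b - A (X n)) = - adjoint A (A (X n) - b)"
      by (metis adj_lin linear_neg minus_diff_eq)
    then show ?thesis
      using assms(9)[of "Suc n"] by (simp add: objective_gradient_def algebra_simps)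
  qed
  have W_min: "?E (X n) (W (Suc n)) \<le> ?E (X n) V" for n V
    unfolding Wn by (rule objective_soft_threshold_le) (use pos assms(6) in auto)
  \<comment> \<open>Pairing the gradient with the increment yields the quadratic terms of the
    expansion with the opposite sign and twice the size, so half of them remain as decrease;
    concavity makes the \<open>Psi_hat\<close> remainder nonpositive.\<close>
  have descent: "?E (X (Suc n)) (W (Suc n)) + \<rho> / 2 * (norm (\<Delta>X (Suc n)))\<^sup>2 \<le> ?E (X n) (W (Suc n))" for n
  proof -
    let ?D = "\<Delta>X (Suc n)"
    have D: "X (Suc n) - X n = ?D" by (simp add: Xn)
    have "?G n \<bullet> ?D = - (norm (A ?D))\<^sup>2 - \<rho> * (norm ?D)\<^sup>2"
      unfolding Gn by (simp add: inner_add_left adjoint_clauses(2)[OF A] power2_norm_eq_inner inner_diff_left)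
    moreover have "Psi_hat \<alpha> (X (Suc n)) - Psi_hat \<alpha> (X n) - ?P n \<bullet> ?D \<le> 0"
      using Psi_hat_concave[OF pos(1), of "X (Suc n)" "X n"] by (simp add: D)
    then have "lam * \<beta> * (Psi_hat \<alpha> (X (Suc n)) - Psi_hat \<alpha> (X n) - ?P n \<bullet> ?D) \<le> 0"
      using pos by (intro mult_nonneg_nonpos) auto
    moreover have "0 \<le> (norm (A ?D))\<^sup>2" by simp
    ultimately show ?thesis
      using objective_expansion[OF A, of \<alpha> \<beta> lam \<rho> b "X (Suc n)" "W (Suc n)" "X n" "?P n"]
      unfolding D by linarith
  qed
  \<comment> \<open>The values start at index 1 because the hypotheses say nothing about
    \<open>W 0\<close>.\<close>
  define e where "e n = ?E (X (Suc n)) (W (Suc n))" for n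
  have e_step: "e (Suc n) + \<rho> / 2 * (norm (\<Delta>X (Suc (Suc n))))\<^sup>2 \<le> e n" for n
    using descent[of "Suc n"] W_min[of "Suc n" "W (Suc n)"] by (simp add: e_def)
  have "e (Suc n) \<le> e n" for n
  proof -
    have "0 \<le> \<rho> / 2 * (norm (\<Delta>X (Suc (Suc n))))\<^sup>2" using pos by simp
    with e_step[of n] show ?thesis by linarith
  qed
  then have dec: "decseq e" by (rule decseq_SucI)
  obtain K where K: "\<And>X W. lam * norm W + norm (X - W) \<le> ?E X W + K"
    using objective_coercive[OF pos, of A b] by blast
  have e_bound: "lam * norm (W (Suc n)) + norm (X (Suc n) - W (Suc n)) \<le> e 0 + K" for n
    using K[of "W (Suc n)" "X (Suc n)"] decseqD[OF dec, of 0 n] by (simp add: e_def)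
  have "- K \<le> e n" for n
  proof -
    have "0 \<le> lam * norm (W (Suc n)) + norm (X (Suc n) - W (Suc n))" using pos by simp
    then show ?thesis using K[of "W (Suc n)" "X (Suc n)"] by (simp add: e_def)
  qed
  then obtain L where L: "e \<longlonglongrightarrow> L" using decseq_convergent[OF dec] by metis
  \<comment> \<open>Each squared increment is bounded by a multiple of the drop between consecutive
    values of \<open>e\<close>, and these drops tend to 0 since \<open>e\<close> converges.\<close>
  have \<Delta>X0: "(\<lambda>n. \<Delta>X (Suc (Suc n))) \<longlonglongrightarrow> 0"
  proof -
    have "(\<lambda>n. 2 / \<rho> * (e n - e (Suc n))) \<longlonglongrightarrow> 2 / \<rho> * (L - L)"
      by (intro tendsto_intros L LIMSEQ_Suc)
    then have lim: "(\<lambda>n. 2 / \<rho> * (e n - e (Suc n))) \<longlonglongrightarrow> 0" by simp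
    have "(norm (\<Delta>X (Suc (Suc n))))\<^sup>2 \<le> 2 / \<rho> * (e n - e (Suc n))" for n
      using e_step[of n] pos by (simp add: field_simps)
    then have "\<forall>\<^sub>F n in sequentially. norm ((norm (\<Delta>X (Suc (Suc n))))\<^sup>2) \<le> 2 / \<rho> * (e n - e (Suc n))"
      by (intro always_eventually) simp
    then have "(\<lambda>n. (norm (\<Delta>X (Suc (Suc n))))\<^sup>2) \<longlonglongrightarrow> 0"
      using lim by (rule Lim_null_comparison)
    then have "(\<lambda>n. sqrt ((norm (\<Delta>X (Suc (Suc n))))\<^sup>2)) \<longlonglongrightarrow> sqrt 0"
      by (rule tendsto_real_sqrt)
    then show ?thesis by (simp add: tendsto_norm_zero_iff)
  qed
  text \<open>The shift by two leaves room for the predecessor \<open>X (s - 1)\<close> and for \<open>e_step\<close>.\<close>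
  have "bounded (range (\<lambda>n. (W (Suc (Suc n)), X (Suc (Suc n)))))"
    unfolding bounded_iff
  proof (intro exI ballI)
    fix z assume "z \<in> range (\<lambda>n. (W (Suc (Suc n)), X (Suc (Suc n))))"
    then obtain n where z: "z = (W (Suc (Suc n)), X (Suc (Suc n)))" by blast
    have "0 \<le> lam * norm (W (Suc (Suc n)))" using pos by simp
    then have "lam * norm (W (Suc (Suc n))) \<le> e 0 + K" "norm (X (Suc (Suc n)) - W (Suc (Suc n))) \<le> e 0 + K"
      using e_bound[of "Suc n"] norm_ge_zero[of "X (Suc (Suc n)) - W (Suc (Suc n))"] by linarith+
    then have "norm (W (Suc (Suc n))) \<le> (e 0 + K) / lam" "norm (X (Suc (Suc n)) - W (Suc (Suc n))) \<le> e 0 + K"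
      using pos by (simp_all add: field_simps)
    moreover have "norm (X (Suc (Suc n))) \<le> norm (W (Suc (Suc n))) + norm (X (Suc (Suc n)) - W (Suc (Suc n)))"
      by (rule norm_triangle_sub)
    moreover have "norm z \<le> norm (W (Suc (Suc n))) + norm (X (Suc (Suc n)))"
      unfolding z by (rule norm_Pair_le)
    ultimately show "norm z \<le> 2 * ((e 0 + K) / lam) + (e 0 + K)" by linarith
  qed
  then obtain l and p :: "nat \<Rightarrow> nat" where p: "strict_mono p"
    and lim: "((\<lambda>n. (W (Suc (Suc n)), X (Suc (Suc n)))) \<circ> p) \<longlonglongrightarrow> l"
    using bounded_imp_convergent_subsequence by blast
  obtain Ws Xs where l: "l = (Ws, Xs)" by (cases l)
  have WX: "(\<lambda>k. (W (Suc (Suc (p k))), X (Suc (Suc (p k))))) \<longlonglongrightarrow> (Ws, Xs)"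
    using lim by (simp add: o_def l)
  have WL: "(\<lambda>k. W (Suc (Suc (p k)))) \<longlonglongrightarrow> Ws" and XL: "(\<lambda>k. X (Suc (Suc (p k)))) \<longlonglongrightarrow> Xs"
    using tendsto_fst[OF WX] tendsto_snd[OF WX] by simp_all
  have DL: "(\<lambda>k. \<Delta>X (Suc (Suc (p k)))) \<longlonglongrightarrow> 0"
    using LIMSEQ_subseq_LIMSEQ[OF \<Delta>X0 p] by (simp add: o_def)
  \<comment> \<open>The optimality relations hold for \<open>W s\<close> paired with
    \<open>X (s - 1)\<close>, so the predecessors must have the same limit as
    \<open>X s\<close>.\<close>
  have XpL: "(\<lambda>k. X (Suc (p k))) \<longlonglongrightarrow> Xs"
    using tendsto_diff[OF XL DL] by (simp add: Xn)
  have contA: "isCont A x" for x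
    using A by (simp add: linear_continuous_at linear_conv_bounded_linear)
  have contadj: "isCont (adjoint A) x" for x
    using adj_lin by (simp add: linear_continuous_at linear_conv_bounded_linear)
  \<comment> \<open>\<open>Ps\<close> is obtained by solving the stationarity equation at the limit,
    so \<open>G0\<close> holds by construction. What remains is that \<open>Ps\<close> is the
    gradient of \<open>Psi_hat\<close> at \<open>Xs\<close>.\<close>
  define Ps where "Ps = (1 / (lam * \<beta>)) *\<^sub>R (- (adjoint A (A Xs - b) + \<rho> *\<^sub>R (Xs - Ws)))"
  have G0: "objective_gradient \<beta> lam \<rho> A b Ps Xs Ws = 0"
    using pos by (simp add: objective_gradient_def Ps_def)
  have GL: "(\<lambda>k. ?G (Suc (p k))) \<longlonglongrightarrow> 0"
  proof -
    have "(\<lambda>k. - (adjoint A (A (\<Delta>X (Suc (Suc (p k))))) + \<rho> *\<^sub>R \<Delta>X (Suc (Suc (p k)))))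
        \<longlonglongrightarrow> - (adjoint A (A 0) + \<rho> *\<^sub>R 0)"
      by (intro tendsto_intros DL isCont_tendsto_compose[OF contA] isCont_tendsto_compose[OF contadj])
    then show ?thesis unfolding Gn by (simp add: linear_0[OF A] linear_0[OF adj_lin])
  qed
  have PL: "(\<lambda>k. ?P (Suc (p k))) \<longlonglongrightarrow> Ps"
  proof -
    have "?P n = (1 / (lam * \<beta>)) *\<^sub>R (?G n - (adjoint A (A (X n) - b) + \<rho> *\<^sub>R (X n - W (Suc n))))" for n
      using pos by (simp add: objective_gradient_def)
    moreover have "(\<lambda>k. (1 / (lam * \<beta>)) *\<^sub>R (?G (Suc (p k))
        - (adjoint A (A (X (Suc (p k))) - b) + \<rho> *\<^sub>R (X (Suc (p k)) - W (Suc (Suc (p k)))))))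
      \<longlonglongrightarrow> (1 / (lam * \<beta>)) *\<^sub>R (0 - (adjoint A (A Xs - b) + \<rho> *\<^sub>R (Xs - Ws)))"
      by (intro tendsto_intros GL XpL WL isCont_tendsto_compose[OF contA] isCont_tendsto_compose[OF contadj])
    ultimately show ?thesis by (simp add: Ps_def)
  qed
  \<comment> \<open>Closedness of the quadratic estimate takes the place of continuity of the
    gradient map.\<close>
  have "quadratic_approx (\<alpha>\<^sup>2) (Psi_hat \<alpha>) Ps Xs"
    by (rule quadratic_approx_limit[OF _ XpL PL])
      (rule Psi_hat_quadratic_approx[OF pos(1)],
       rule quadratic_approx_isCont[OF Psi_hat_quadratic_approx[OF pos(1)]])
  then obtain C where "quadratic_approx C (\<lambda>X. ?E X Ws) 0 Xs"
    using objective_quadratic_approx[OF A pos(2-4), where W = Ws and P = Ps and X = Xs] G0 by metis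
  then have crit_X: "has_gateaux_gradient (\<lambda>X. ?E X Ws) 0 Xs"
    by (rule quadratic_approx_gateaux)
  \<comment> \<open>That 0 is a subgradient means that \<open>Ws\<close> is a global minimiser, and
    minimality of each \<open>W s\<close> against a fixed competitor \<open>V\<close> passes to the
    limit by continuity.\<close>
  have crit_W: "?E Xs Ws \<le> ?E Xs V" for V
  proof -
    have "isCont (Psi_hat \<alpha>) x" for x :: "real^'n2^'n1"
      by (rule quadratic_approx_isCont[OF Psi_hat_quadratic_approx[OF pos(1)]])
    note conts = this contA continuous_nuclear_norm
    have "(\<lambda>k. ?E (X (Suc (p k))) (W (Suc (Suc (p k))))) \<longlonglongrightarrow> ?E Xs Ws"
      "(\<lambda>k. ?E (X (Suc (p k))) V) \<longlonglongrightarrow> ?E Xs V"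
      unfolding objective_def
      by (intro tendsto_intros XpL WL conts[THEN isCont_tendsto_compose])+
    then show ?thesis by (rule LIMSEQ_le) (use W_min in blast)
  qed
  show ?thesis
  proof (intro exI conjI)
    show "strict_mono (\<lambda>k. Suc (Suc (p k)))" using p by (simp add: strict_mono_def)
    show "is_critical_point ?E (Ws, Xs)"
      using crit_X crit_W by (simp add: is_critical_point_def subdifferential_def)
  qed (use WX in auto)
qed

end
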